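(* Let $\varepsilon\in[0,\frac{616}{634})$ and let $S\in\mathbb{R}^{p\times n}$ be an $(\varepsilon,d,m)$ oblivious $\ell_2$-subspace embedding. Suppose $V\in\mathbb{R}^{n\times m}$ has full rank, $1<m\le p\le n$, $nm\mathbf{u}\le\frac1{12}$, $p^{3/2}\mathbf{u}\le\frac1{12}$, and $$\delta:=\frac{383\left(pm^{3/2}+\sqrt m\left(p^{3/2}\sqrt{1+\varepsilon}+n\|S\|_F\right)\right)}{\sqrt{1-\varepsilon}}\,\mathbf{u}\,\kappa(V)\le1 .$$ Let $\hat Q,\hat R$ be the factors computed in floating point arithmetic by $\texttt{rand\_cholQR}$ applied to $V$ with the single sketch $S$. Then, with probability at least $1-d$, $$\|\hat Q^T\hat Q-I\|_2\le\frac{5445}{\left(25\sqrt{\frac{1-\varepsilon}{1+\varepsilon}}-3\right)^2}(nm+m(m+1))\mathbf{u}$$ and $$\|V-\hat Q\hat R\|_2\le\left(\frac{56}{25\frac{1-\varepsilon}{\sqrt{1+\varepsilon}}-3\sqrt{1-\varepsilon}}+\frac{1.5}{\sqrt{1-\varepsilon}}\sqrt{1+\frac{5445(nm+m(m+1))\mathbf{u}}{\left(25\sqrt{\frac{1-\varepsilon}{1+\varepsilon}}-3\right)^2}}\right)\left(\sqrt{1+\varepsilon}\,\|V\|_2+\frac{\sqrt{1-\varepsilon}}{12}\sigma_m(V)\,\delta\right)m^2\mathbf{u}+\frac{\delta}{10}\sigma_m(V).$$ (That is, the orthogonality error is $O(\mathbf{u})$ and the factorization error is $O(\mathbf{u}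)\|V\|_2$.)
   Context: Embeddings. For $\varepsilon\in[0,1)$, a matrix $S\in\mathbb{R}^{p\times n}$ is an $\varepsilon$-subspace embedding for a subspace $\mathcal V\subset\mathbb{R}^n$ if $|\langle x,y\rangle-\langle Sx,Sy\rangle|\le\varepsilon\|x\|_2\|y\|_2$ for all $x,y\in\mathcal V$. A random $S\in\mathbb{R}^{p\times n}$ is an $(\varepsilon,d,m)$ oblivious $\ell_2$-subspace embedding if, for any fixed $m$-dimensional subspace $\mathcal V\subset\mathbb{R}^n$, it is an $\varepsilon$-subspace embedding for $\mathcal V$ with probability at least $1-d$. Probabilities are over the draw of $S$; $V$ is fixed. The norm of $S$ appearing in $\delta$ is that of the drawn matrix, for which $\delta\le1$ is assumed. Notation. $\sigma_1\ge\dots\ge\sigma_m$ are singular values, $\kappa(V)=\sigma_1(V)/\sigma_m(V)$, $\mathbf{u}$ is the unit roundoff, $\gamma_k=\frac{k\mathbf{u}}{1-k\mathbf{u}}$, $|A|$ is the entrywise absolute value (inequalities between such matrices are entrywise), hats denote computed quantities. Algorithm $\texttt{randQR}$ with a single sketch $S$ (the two-sketch algorithm with $S_1=S$, $S_2=I_p$): (1) compute $W=SV$; (2) compute a Householder QR factorization of $W$, keeping its $m\times m$ upper triangular factor $R$; (3) compute $Q=VR^{-1}$ by solving the triangular system $QR=V$ row by row. Output $Q,R$. Algorithm $\texttt{cholQR}(X)$: (1) compute $G=X^TX$; (2) compute the Cholesky factor $R$, $G=R^TR$; (3) compute $Q=XR^{-1}$ by solving $QR=X$ row by row. Output $Q,R$.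 Algorithm $\texttt{rand\_cholQR}$ with a single sketch $S$: (1) obtain $Q_0,R_0$ from $\texttt{randQR}$ applied to $V$ with sketch $S$; (2) $[Q,R_1]=\texttt{cholQR}(Q_0)$; (3) $R=R_1R_0$. Output $Q,R$. Floating point. All steps are executed in the standard model of floating point arithmetic with unit roundoff $\mathbf{u}$ (each elementary operation has relative error at most $\mathbf{u}$, no overflow or underflow). The standard rounding error bounds for the subroutines are: a computed product of matrices $A,B$ with inner dimension $k$ is $AB+\Delta C$ with $|\Delta C|\le\gamma_k|A||B|$; Householder QR of $\hat W\in\mathbb{R}^{p\times m}$ returns upper triangular $\hat R$ for which there is a $Q_{tmp}\in\mathbb{R}^{p\times m}$ with exactly orthonormal columns and $\hat W+E_2=Q_{tmp}\hat R$, where $\|(E_2)_j\|_2\le\gamma_{29pm}\|\hat w_j\|_2$ for each column $j$; the row-wise solution of $Q\hat R=V$ returns $\hat Q$ with $\hat Q_{i,:}(\hat R+\Delta R_i)=V_{i,:}$, $|\Delta R_i|\le\gamma_m|\hat R|$, for each row $i$; the Cholesky factorization of a computed $\hat G\in\mathbb{R}^{m\times m}$ returns $\hat R$ with $\hat R^T\hat R=\hat G+E$, $|E|\le\gamma_{m+1}|\hat R|^T|\hat R|$. *)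

theory Defs
  imports "HOL-Probability.Probability"
begin

text \<open>
  A matrix with \<open>a\<close> rows and \<open>b\<close> columns has type \<open>real ^ 'b ^ 'a\<close>.  On such matrices \<open>norm\<close> is the
  Frobenius norm, while \<open>\<bar>_\<bar>\<close> and \<open>\<le>\<close> are entrywise.  The index type of the columns of \<open>V\<close> carries a
  linear order, which is what gives upper triangularity its meaning.
\<close>

abbreviation spectral_norm :: "real ^ 'b ^ 'a \<Rightarrow> real"
  where "spectral_norm A \<equiv> onorm ((*v) A)"

text \<open>
  For a matrix with at least as many rows as columns these are exactly its singular values, without
  multiplicity; for a wide matrix the set may contain an additional \<open>0\<close>.
\<close>
definition singular_values :: "real ^ 'b ^ 'a \<Rightarrow> real set"
  where "singular_values A =
    {s. 0 \<le> s \<and> (\<exists>x. x \<noteq> 0 \<and> (transpose A ** A) *v x = s\<^sup>2 *\<^sub>R x)}"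

definition sigma_max :: "real ^ 'b ^ 'a \<Rightarrow> real"
  where "sigma_max A = Max (singular_values A)"

definition sigma_min :: "real ^ 'b ^ 'a \<Rightarrow> real"
  where "sigma_min A = Min (singular_values A)"

definition condition_number :: "real ^ 'b ^ 'a \<Rightarrow> real"
  where "condition_number A = sigma_max A / sigma_min A"

definition subspace_embedding :: "real \<Rightarrow> real ^ 'n ^ 'p \<Rightarrow> (real ^ 'n) set \<Rightarrow> bool"
  where "subspace_embedding \<epsilon> S W \<longleftrightarrow>
    (\<forall>x\<in>W. \<forall>y\<in>W. \<bar>x \<bullet> y - (S *v x) \<bullet> (S *v y)\<bar> \<le> \<epsilon> * norm x * norm y)"

text \<open>
  The event in question is closed in \<open>S \<omega>\<close>, hence measurable, so that \<open>\<P>\<close> is its genuine probability.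
\<close>
definition oblivious_subspace_embedding ::
    "'w measure \<Rightarrow> ('w \<Rightarrow> real ^ 'n ^ 'p) \<Rightarrow> real \<Rightarrow> real \<Rightarrow> nat \<Rightarrow> bool"
  where "oblivious_subspace_embedding M S \<epsilon> d m \<longleftrightarrow>
    S \<in> borel_measurable M \<and>
    (\<forall>W. subspace W \<and> dim W = m \<longrightarrow> \<P>(\<omega> in M. subspace_embedding \<epsilon> (S \<omega>) W) \<ge> 1 - d)"

text \<open>
  The property \<open>P\<close> may quantify over all possible rounding errors and need not be measurable, so
  ``with probability at least \<open>q\<close>'' means that \<open>P\<close> holds on a measurable event of at least that
  probability.  For measurable \<open>P\<close> this is the usual notion.
\<close>
definition holds_with_prob_ge :: "'w measure \<Rightarrow> real \<Rightarrow> ('w \<Rightarrow> bool) \<Rightarrow> bool"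
  where "holds_with_prob_ge M q P \<longleftrightarrow> (\<exists>A\<in>sets M. measure M A \<ge> q \<and> (\<forall>\<omega>\<in>A. P \<omega>))"

text \<open>Only meaningful for \<open>k * u < 1\<close>.\<close>
definition gam :: "real \<Rightarrow> nat \<Rightarrow> real"
  where "gam u k = real k * u / (1 - real k * u)"

definition upper_triangular :: "real ^ ('m :: {finite, linorder}) ^ ('m :: {finite, linorder}) \<Rightarrow> bool"
  where "upper_triangular R \<longleftrightarrow> (\<forall>i j. j < i \<longrightarrow> R $ i $ j = 0)"

text \<open>
  The predicates \<open>fl_\<dots>\<close> relate the input of a routine to every output that is admissible in floating
  point arithmetic with unit roundoff \<open>u\<close> according to the standard error bound of that routine; \<open>u\<close> is
  the first argument, and outputs come last.
\<close>

definition fl_matmul :: "real \<Rightarrow> real ^ 'k ^ 'a \<Rightarrow> real ^ 'b ^ 'k \<Rightarrow> real ^ 'b ^ 'a \<Rightarrow> bool"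
  where "fl_matmul u A B C \<longleftrightarrow>
    (\<exists>\<Delta>C. C = A ** B + \<Delta>C \<and> \<bar>\<Delta>C\<bar> \<le> gam u CARD('k) *\<^sub>R (\<bar>A\<bar> ** \<bar>B\<bar>))"

definition fl_householder_R ::
    "real \<Rightarrow> real ^ ('m :: {finite, linorder}) ^ 'p \<Rightarrow>
     real ^ ('m :: {finite, linorder}) ^ ('m :: {finite, linorder}) \<Rightarrow> bool"
  where "fl_householder_R u W R \<longleftrightarrow>
    upper_triangular R \<and>
    (\<exists>(Qtmp :: real ^ ('m :: {finite, linorder}) ^ 'p) E.
       transpose Qtmp ** Qtmp = mat 1 \<and> W + E = Qtmp ** R \<and>
       (\<forall>j. norm (column j E) \<le> gam u (29 * CARD('p) * CARD('m)) * norm (column j W)))"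

text \<open>The perturbation of \<open>R\<close> depends on the row \<open>i\<close>.\<close>
definition fl_solve_rows ::
    "real \<Rightarrow> real ^ ('m :: {finite, linorder}) ^ ('m :: {finite, linorder}) \<Rightarrow>
     real ^ ('m :: {finite, linorder}) ^ 'n \<Rightarrow> real ^ ('m :: {finite, linorder}) ^ 'n \<Rightarrow>
     bool"
  where "fl_solve_rows u R X Q \<longleftrightarrow>
    (\<forall>i. \<exists>\<Delta>R. row i Q v* (R + \<Delta>R) = row i X \<and> \<bar>\<Delta>R\<bar> \<le> gam u CARD('m) *\<^sub>R \<bar>R\<bar>)"

definition fl_cholesky ::
    "real \<Rightarrow> real ^ ('m :: {finite, linorder}) ^ ('m :: {finite, linorder}) \<Rightarrow>
     real ^ ('m :: {finite, linorder}) ^ ('m :: {finite, linorder}) \<Rightarrow> bool"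
  where "fl_cholesky u G R \<longleftrightarrow>
    upper_triangular R \<and>
    (\<exists>E. transpose R ** R = G + E \<and>
         \<bar>E\<bar> \<le> gam u (CARD('m) + 1) *\<^sub>R (\<bar>transpose R\<bar> ** \<bar>R\<bar>))"

definition fl_randQR ::
    "real \<Rightarrow> real ^ 'n ^ 'p \<Rightarrow>
     real ^ ('m :: {finite, linorder}) ^ 'n \<Rightarrow>
     real ^ ('m :: {finite, linorder}) ^ 'n \<Rightarrow>
     real ^ ('m :: {finite, linorder}) ^ ('m :: {finite, linorder}) \<Rightarrow> bool"
  where "fl_randQR u S V Q R \<longleftrightarrow>
    (\<exists>W. fl_matmul u S V W \<and> fl_householder_R u W R \<and> fl_solve_rows u R V Q)"

definition fl_cholQR ::
    "real \<Rightarrow> real ^ ('m :: {finite, linorder}) ^ 'n \<Rightarrow>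
     real ^ ('m :: {finite, linorder}) ^ 'n \<Rightarrow>
     real ^ ('m :: {finite, linorder}) ^ ('m :: {finite, linorder}) \<Rightarrow> bool"
  where "fl_cholQR u X Q R \<longleftrightarrow>
    (\<exists>G. fl_matmul u (transpose X) X G \<and> fl_cholesky u G R \<and> fl_solve_rows u R X Q)"

definition fl_rand_cholQR ::
    "real \<Rightarrow> real ^ 'n ^ 'p \<Rightarrow>
     real ^ ('m :: {finite, linorder}) ^ 'n \<Rightarrow>
     real ^ ('m :: {finite, linorder}) ^ 'n \<Rightarrow>
     real ^ ('m :: {finite, linorder}) ^ ('m :: {finite, linorder}) \<Rightarrow> bool"
  where "fl_rand_cholQR u S V Q R \<longleftrightarrow>
    (\<exists>Q\<^sub>0 R\<^sub>0 R\<^sub>1. fl_randQR u S V Q\<^sub>0 R\<^sub>0 \<and> fl_cholQR u Q\<^sub>0 Q R\<^sub>1 \<and> fl_matmul u R\<^sub>1 R\<^sub>0 R)"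

definition sketch_delta :: "real \<Rightarrow> real \<Rightarrow> real ^ 'n ^ 'p \<Rightarrow> real ^ 'm ^ 'n \<Rightarrow> real"
  where "sketch_delta \<epsilon> u S V =
    383 * (real CARD('p) * real CARD('m) powr (3/2)
           + sqrt (real CARD('m))
             * (real CARD('p) powr (3/2) * sqrt (1 + \<epsilon>) + real CARD('n) * norm S))
      / sqrt (1 - \<epsilon>) * u * condition_number V"

end

theory Submission
  imports Defs
begin

text \<open>
  On the embedding event, \<open>S V + E\<close> is a matrix with orthonormal columns times \<open>R\<^sub>0\<close>, where \<open>E\<close> is small
  relative to \<open>\<sigma>\<^sub>m(S V)\<close> because \<open>\<delta> \<le> 1\<close>.  Hence \<open>\<parallel>R\<^sub>0 x\<parallel>\<close> is within about 11 percent of \<open>\<parallel>S V x\<parallel>\<close>, and the computed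
  \<open>Q\<^sub>0 \<approx> V R\<^sub>0\<^sup>-\<^sup>1\<close> has singular values between \<open>0.866 / sqrt (1 + \<epsilon>)\<close> and \<open>1.132 / sqrt (1 - \<epsilon>)\<close>, whatever the
  condition number of \<open>V\<close>.  An embedding satisfies \<open>\<parallel>S\<parallel>\<^sub>F \<ge> sqrt (m (1 - \<epsilon>))\<close>, so \<open>\<delta> \<le> 1\<close> also forces
  \<open>n m u \<le> 1 / 383\<close>.  The Gram matrix of \<open>Q\<^sub>0\<close> therefore dominates the rounding errors of the Cholesky
  step, which makes \<open>R\<^sub>1\<close> invertible and \<open>\<bar>\<parallel>Q x\<parallel>\<^sup>2 - \<parallel>x\<parallel>\<^sup>2\<bar>\<close> of order \<open>u\<close>.  All comparisons are made
  between \<open>\<parallel>V x\<parallel>\<close>, \<open>\<parallel>S V x\<parallel>\<close>, \<open>\<parallel>R\<^sub>0 x\<parallel>\<close>, and so on for a fixed vector, so that no inverse matrix is ever needed.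
\<close>

section \<open>The Frobenius norm\<close>

lemma norm_matrix_sq_rows: "(norm (A :: real ^ 'b ^ 'a))\<^sup>2 = (\<Sum>i\<in>UNIV. (norm (row i A))\<^sup>2)"
  by (simp add: norm_vec_def L2_set_def row_def sum_nonneg)

lemma norm_matrix_sq_entries:
  "(norm (A :: real ^ 'b ^ 'a))\<^sup>2 = (\<Sum>i\<in>UNIV. \<Sum>j\<in>UNIV. (A $ i $ j)\<^sup>2)"
  by (simp add: norm_vec_def L2_set_def sum_nonneg)

lemma norm_transpose: "norm (transpose A) = norm (A :: real ^ 'b ^ 'a)"
proof -
  have "(norm (transpose A))\<^sup>2 = (norm A)\<^sup>2"
    unfolding norm_matrix_sq_entries by (simp add: transpose_def) (rule sum.swap)
  then show ?thesis by simp
qed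

lemma norm_matrix_sq_columns: "(norm (A :: real ^ 'b ^ 'a))\<^sup>2 = (\<Sum>j\<in>UNIV. (norm (column j A))\<^sup>2)"
  using norm_matrix_sq_rows[of "transpose A"] by (simp add: norm_transpose)

lemma norm_le_entrywise:
  fixes A B :: "real ^ 'b ^ 'a"
  assumes "\<bar>A\<bar> \<le> B"
  shows "norm A \<le> norm B"
proof -
  have "(A $ i $ j)\<^sup>2 \<le> (B $ i $ j)\<^sup>2" for i j
  proof -
    have "\<bar>A $ i $ j\<bar> \<le> B $ i $ j"
      using assms by (simp add: less_eq_vec_def abs_vec_def)
    then show ?thesis by (simp add: abs_le_square_iff[symmetric])
  qed
  then have "(norm A)\<^sup>2 \<le> (norm B)\<^sup>2"
    unfolding norm_matrix_sq_entries by (intro sum_mono)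
  then show ?thesis by (simp add: power2_le_iff_abs_le)
qed

lemma norm_abs_matrix: "norm \<bar>A :: real ^ 'b ^ 'a\<bar> = norm A"
proof -
  have "(norm \<bar>A\<bar>)\<^sup>2 = (norm A)\<^sup>2"
    unfolding norm_matrix_sq_entries by (simp add: abs_vec_def)
  then show ?thesis by simp
qed

lemma norm_mult_vec_le: "norm ((A :: real ^ 'b ^ 'a) *v x) \<le> norm A * norm x"
proof -
  have "(norm (A *v x))\<^sup>2 = (\<Sum>i\<in>UNIV. (row i A \<bullet> x)\<^sup>2)"
    by (simp add: matrix_mult_dot norm_vec_def L2_set_def sum_nonneg row_def)
  also have "\<dots> \<le> (\<Sum>i\<in>UNIV. (norm (row i A))\<^sup>2 * (norm x)\<^sup>2)"
    by (intro sum_mono) (metis Cauchy_Schwarz_ineq2 abs_le_square_iff abs_mult abs_norm_cancel power_mult_distrib)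
  also have "\<dots> = (norm A * norm x)\<^sup>2"
    by (simp add: norm_matrix_sq_rows power_mult_distrib sum_distrib_right)
  finally show ?thesis by (rule power2_le_imp_le) simp
qed

lemma column_matrix_mult: "column j (A ** B) = A *v column j (B :: real ^ 'b ^ 'a)"
  by (simp add: column_def matrix_matrix_mult_def matrix_vector_mult_def vec_eq_iff)

lemma norm_mult_le_op:
  fixes A :: "real ^ 'k ^ 'a" and B :: "real ^ 'b ^ 'k"
  assumes "\<And>x. norm (A *v x) \<le> c * norm x" "0 \<le> c"
  shows "norm (A ** B) \<le> c * norm B"
proof -
  have "(norm (A ** B))\<^sup>2 \<le> (\<Sum>j\<in>UNIV. (c * norm (column j B))\<^sup>2)"
    unfolding norm_matrix_sq_columns column_matrix_mult
    by (intro sum_mono power_mono assms) simp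
  also have "\<dots> = (c * norm B)\<^sup>2"
    by (simp add: norm_matrix_sq_columns power_mult_distrib sum_distrib_left)
  finally show ?thesis by (rule power2_le_imp_le) (simp add: assms)
qed

lemma norm_matrix_mult_le: "norm (A ** B) \<le> norm A * norm (B :: real ^ 'b ^ 'k)"
  by (rule norm_mult_le_op) (simp_all add: norm_mult_vec_le)

lemma frobenius_le_op:
  fixes A :: "real ^ 'b ^ 'a"
  assumes "\<And>x. norm (A *v x) \<le> c * norm x" "0 \<le> c"
  shows "norm A \<le> sqrt (real CARD('b)) * c"
proof -
  have "(norm A)\<^sup>2 \<le> (\<Sum>j\<in>(UNIV :: 'b set). c\<^sup>2)"
    unfolding norm_matrix_sq_columns
  proof (rule sum_mono)
    fix j :: 'b
    have "norm (column j A) \<le> c * norm (axis j 1 :: real ^ 'b)"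
      using assms(1)[of "axis j 1"] by (simp add: matrix_vector_mult_basis)
    then show "(norm (column j A))\<^sup>2 \<le> c\<^sup>2" by (simp add: norm_axis_1 power_mono)
  qed
  also have "\<dots> = (sqrt (real CARD('b)) * c)\<^sup>2" by (simp add: power_mult_distrib)
  finally show ?thesis by (rule power2_le_imp_le) (simp add: assms)
qed

section \<open>Quadratic forms and operator norms\<close>

lemma transpose_diff: "transpose (A - B) = transpose A - transpose (B :: real ^ 'b ^ 'a)"
  by (simp add: transpose_def vec_eq_iff)

lemma dot_matrix_vec: "x \<bullet> (A *v y) = (transpose A *v x) \<bullet> (y :: real ^ 'b)"
  by (metis dot_lmul_matrix vector_transpose_matrix inner_commute transpose_transpose)

lemma quadratic_form_gram:
  "x \<bullet> ((transpose A ** A) *v x) = (norm ((A :: real ^ 'b ^ 'a) *v x))\<^sup>2"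
  by (simp only: matrix_vector_mul_assoc[symmetric] dot_matrix_vec transpose_transpose dot_square_norm)

text \<open>Polarization writes the bilinear form as a difference of two values of the quadratic
  form, and the parallelogram law bounds it. Pairing \<open>A *v x\<close> with its own multiple of
  length \<open>norm x\<close> then yields the operator bound. This turns estimates of ||Q x||^2 -
  ||x||^2 into the spectral norm of Q^T Q - I.\<close>

lemma onorm_symmetric_le:
  fixes A :: "real ^ 'b ^ 'b"
  assumes sym: "transpose A = A" and q: "\<And>x. \<bar>x \<bullet> (A *v x)\<bar> \<le> k * (norm x)\<^sup>2"
  shows "onorm ((*v) A) \<le> k"
proof (rule onorm_le)
  fix x :: "real ^ 'b"
  have pol: "4 * (x \<bullet> (A *v y)) \<le> 2 * k * ((norm x)\<^sup>2 + (norm y)\<^sup>2)" for x y :: "real ^ 'b"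
  proof -
    have "y \<bullet> (A *v x) = x \<bullet> (A *v y)"
      by (metis dot_matrix_vec sym inner_commute)
    then have "4 * (x \<bullet> (A *v y)) = (x + y) \<bullet> (A *v (x + y)) - (x - y) \<bullet> (A *v (x - y))"
      by (simp add: matrix_vector_right_distrib algebra_simps)
    also have "\<dots> \<le> k * (norm (x + y))\<^sup>2 + k * (norm (x - y))\<^sup>2"
      using q[of "x + y"] q[of "x - y"] by linarith
    also have "\<dots> = 2 * k * ((norm x)\<^sup>2 + (norm y)\<^sup>2)"
      by (simp add: power2_norm_eq_inner algebra_simps inner_commute)
    finally show ?thesis .
  qed
  show "norm (A *v x) \<le> k * norm x"
  proof (cases "A *v x = 0")
    case True
    have "0 \<le> k * norm x"
    proof (cases "x = 0")
      case False
      have "0 \<le> k * (norm x)\<^sup>2" using q[of x] by linarith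
      with False show ?thesis by (simp add: zero_le_mult_iff)
    qed simp
    with True show ?thesis by simp
  next
    case False
    define y where "y = (norm x / norm (A *v x)) *\<^sub>R (A *v x)"
    have ny: "norm y = norm x" using False by (simp add: y_def)
    have x0: "norm x > 0" using False by auto
    have "y \<bullet> (A *v x) = norm x * norm (A *v x)"
      using False by (simp add: y_def dot_square_norm power2_eq_square)
    with pol[of y x] ny have "norm x * norm (A *v x) \<le> norm x * (k * norm x)"
      by (simp add: power2_eq_square mult.left_commute)
    then show ?thesis using x0 by simp
  qed
qed

lemma norm_mult_vec_le_onorm: "norm ((A :: real ^ 'b ^ 'a) *v x) \<le> onorm ((*v) A) * norm x"
  by (rule onorm) simp

section \<open>Orthonormal systems\<close>

lemma orthonormal_columns_norm:
  fixes A :: "real ^ 'b ^ 'a"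
  assumes "transpose A ** A = mat 1"
  shows "norm (A *v x) = norm x"
proof -
  have "(norm (A *v x))\<^sup>2 = (norm x)\<^sup>2"
    by (simp only: quadratic_form_gram[symmetric] assms matrix_vector_mul_lid dot_square_norm)
  then show ?thesis by simp
qed

lemma bessel_inequality:
  fixes r :: "'a :: euclidean_space"
  assumes "finite B" "pairwise orthogonal B" "\<And>b. b \<in> B \<Longrightarrow> norm b = 1"
  shows "(\<Sum>b\<in>B. (r \<bullet> b)\<^sup>2) \<le> (norm r)\<^sup>2"
proof -
  define y where "y = (\<Sum>b\<in>B. (r \<bullet> b) *\<^sub>R b)"
  have proj: "b \<bullet> y = r \<bullet> b" if "b \<in> B" for b
  proof -
    have "b \<bullet> y = (\<Sum>c\<in>B. if c = b then r \<bullet> b else 0)"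
      unfolding y_def inner_sum_right
    proof (rule sum.cong)
      fix c assume "c \<in> B"
      then show "b \<bullet> ((r \<bullet> c) *\<^sub>R c) = (if c = b then r \<bullet> b else 0)"
        using assms(2,3) that
        by (auto simp: pairwise_def orthogonal_def norm_eq_1)
    qed simp
    then show ?thesis using assms(1) that by simp
  qed
  have ry: "r \<bullet> y = (\<Sum>b\<in>B. (r \<bullet> b)\<^sup>2)"
    by (simp add: y_def inner_sum_right power2_eq_square)
  have "y \<bullet> y = (\<Sum>b\<in>B. (r \<bullet> b) * (b \<bullet> y))"
    by (subst (1) y_def) (simp add: inner_sum_left)
  also have "\<dots> = r \<bullet> y" using ry by (simp add: proj power2_eq_square)
  finally have yy: "y \<bullet> y = r \<bullet> y" .
  have "0 \<le> (r - y) \<bullet> (r - y)" by simp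
  also have "\<dots> = r \<bullet> r - r \<bullet> y" using yy by (simp add: algebra_simps inner_commute)
  finally show ?thesis using ry by (simp add: dot_square_norm)
qed

text \<open>Summed over an orthonormal basis of \<open>W\<close>, the squares of
  \<open>norm (S *v b)\<close> form a Bessel sum for each row of \<open>S\<close>. For an embedding
  this keeps \<open>norm S\<close> away from 0, so that the term of \<open>sketch_delta\<close>
  containing it controls n m u.\<close>

lemma frobenius_ge_on_subspace:
  fixes S :: "real ^ 'n ^ 'p"
  assumes "subspace W" "0 \<le> c" and S: "\<And>x. x \<in> W \<Longrightarrow> c * norm x \<le> norm (S *v x)"
  shows "sqrt (real (dim W)) * c \<le> norm S"
proof -
  obtain B where B: "B \<subseteq> W" "pairwise orthogonal B" "\<And>x. x \<in> B \<Longrightarrow> norm x = 1"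
    "independent B" "card B = dim W"
    using orthonormal_basis_subspace[OF assms(1)] by metis
  have fin: "finite B" using B(4) by (rule independent_imp_finite)
  have "(sqrt (real (dim W)) * c)\<^sup>2 = (\<Sum>b\<in>B. c\<^sup>2)"
    using B(5) by (simp add: power_mult_distrib)
  also have "\<dots> \<le> (\<Sum>b\<in>B. (norm (S *v b))\<^sup>2)"
    using S B(1,3) assms(2) by (intro sum_mono power_mono) force+
  also have "\<dots> = (\<Sum>b\<in>B. \<Sum>i\<in>UNIV. (row i S \<bullet> b)\<^sup>2)"
    by (simp add: matrix_mult_dot norm_vec_def L2_set_def sum_nonneg row_def)
  also have "\<dots> = (\<Sum>i\<in>UNIV. \<Sum>b\<in>B. (row i S \<bullet> b)\<^sup>2)" by (rule sum.swap)
  also have "\<dots> \<le> (\<Sum>i\<in>UNIV. (norm (row i S))\<^sup>2)"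
    by (intro sum_mono bessel_inequality fin B)
  also have "\<dots> = (norm S)\<^sup>2" by (simp add: norm_matrix_sq_rows)
  finally show ?thesis by (rule power2_le_imp_le) simp
qed

section \<open>Singular values\<close>

text \<open>The form attains its minimum 0 at \<open>x\<close>. If \<open>A *v x\<close> were
  nonzero, a short step from \<open>x\<close> against it would make the form negative.\<close>

lemma psd_form_zero:
  fixes A :: "real ^ 'b ^ 'b"
  assumes sym: "transpose A = A" and psd: "\<And>y. 0 \<le> y \<bullet> (A *v y)" and zero: "x \<bullet> (A *v x) = 0"
  shows "A *v x = 0"
proof (rule ccontr)
  assume nz: "A *v x \<noteq> 0"
  define y where "y = A *v x"
  define c where "c = y \<bullet> y"
  define e where "e = y \<bullet> (A *v y)"
  have c: "c > 0" using nz by (simp add: c_def y_def)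
  have e: "e \<ge> 0" using psd by (simp add: e_def)
  have xy: "x \<bullet> (A *v y) = c"
    by (metis c_def dot_matrix_vec sym y_def)
  have poly: "0 \<le> - 2 * t * c + t\<^sup>2 * e" for t
  proof -
    have "(x - t *\<^sub>R y) \<bullet> (A *v (x - t *\<^sub>R y)) = - 2 * t * c + t\<^sup>2 * e"
      using zero xy
      by (simp add: algebra_simps
          power2_eq_square e_def c_def y_def[symmetric])
    then show ?thesis using psd by metis
  qed
  \<comment> \<open>The \<open>+ 1\<close> keeps the quotient meaningful for \<open>e = 0\<close>.
    As \<open>t * e \<le> c\<close>, the polynomial is at most \<open>- t * c\<close>.\<close>
  define t where "t = c / (e + 1)"
  have t: "t > 0" "t * e \<le> c" using c e by (auto simp: t_def field_simps)
  have "0 \<le> - 2 * t * c + t\<^sup>2 * e" by (rule poly)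
  also have "\<dots> = t * (t * e - 2 * c)" by (simp add: power2_eq_square algebra_simps)
  also have "\<dots> < 0" using t c by (intro mult_pos_neg) auto
  finally show False by simp
qed

text \<open>Eigenvectors of the Gram matrix for distinct eigenvalues are orthogonal, hence
  independent, so one chosen per singular value leaves only finitely many. Nonnegativity makes
  distinct singular values have distinct squares. Finiteness gives \<open>Max\<close> and
  \<open>Min\<close> their meaning.\<close>

lemma finite_singular_values: "finite (singular_values (A :: real ^ 'b ^ 'a))"
proof -
  let ?G = "transpose A ** A"
  define f where "f s = (SOME x. x \<noteq> 0 \<and> ?G *v x = s\<^sup>2 *\<^sub>R x)" for s :: real
  have f: "f s \<noteq> 0" "?G *v f s = s\<^sup>2 *\<^sub>R f s" if "s \<in> singular_values A" for s
  proof -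
    have "\<exists>x. x \<noteq> 0 \<and> ?G *v x = s\<^sup>2 *\<^sub>R x" using that by (auto simp: singular_values_def)
    from someI_ex[OF this] show "f s \<noteq> 0" "?G *v f s = s\<^sup>2 *\<^sub>R f s" by (auto simp: f_def)
  qed
  have orth: "f s \<bullet> f t = 0" if "s \<in> singular_values A" "t \<in> singular_values A" "s \<noteq> t" for s t
  proof -
    have "f s \<bullet> (?G *v f t) = (?G *v f s) \<bullet> f t"
      by (simp add: dot_matrix_vec matrix_transpose_mul)
    then have "(t\<^sup>2 - s\<^sup>2) * (f s \<bullet> f t) = 0"
      using f(2)[OF that(1)] f(2)[OF that(2)] by (simp add: algebra_simps)
    moreover have "t\<^sup>2 \<noteq> s\<^sup>2" using that by (auto simp: singular_values_def)
    ultimately show ?thesis by simp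
  qed
  have inj: "inj_on f (singular_values A)"
    using orth f(1) by (metis inj_onI inner_eq_zero_iff)
  have "pairwise orthogonal (f ` singular_values A)"
    using orth by (auto simp: pairwise_def orthogonal_def)
  moreover have "0 \<notin> f ` singular_values A" using f(1) by force
  ultimately have "independent (f ` singular_values A)"
    by (rule pairwise_orthogonal_independent)
  then have "finite (f ` singular_values A)" by (rule independent_imp_finite)
  then show ?thesis using inj by (rule finite_imageD)
qed

text \<open>The sign \<open>c\<close> treats maximum and minimum together. Extremality makes the
  form of \<open>c\<close> times (s^2 I - A^T A) nonnegative with value 0 at \<open>x\<close>, and
  \<open>psd_form_zero\<close> turns this into the eigenvector equation.\<close>

lemma sphere_extremal_singular_value:
  fixes A :: "real ^ 'b ^ 'a"
  assumes x: "norm x = 1" and c: "c = 1 \<or> c = -1"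
    and ext: "\<And>y. norm y = 1 \<Longrightarrow> c * (norm (A *v y))\<^sup>2 \<le> c * (norm (A *v x))\<^sup>2"
  shows "norm (A *v x) \<in> singular_values A"
proof -
  define s where "s = norm (A *v x)"
  define B where "B = c *\<^sub>R (s\<^sup>2 *\<^sub>R mat 1 - transpose A ** A)"
  define G where "G = transpose A ** A"
  have G: "transpose G = G" by (simp add: G_def matrix_transpose_mul)
  have symG: "G $ i $ j = G $ j $ i" for i j
    by (subst (1) G[symmetric]) (simp add: transpose_def)
  have "B $ i $ j = B $ j $ i" for i j
    unfolding B_def G_def[symmetric] by (cases "i = j") (simp_all add: mat_def symG[of i j])
  then have symB: "transpose B = B" by (simp add: vec_eq_iff transpose_def)
  have Bv: "B *v y = c *\<^sub>R (s\<^sup>2 *\<^sub>R y - (transpose A ** A) *v y)" for y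
    by (simp add: B_def scaleR_matrix_vector_assoc[symmetric] matrix_vector_mult_diff_rdistrib)
  have q: "y \<bullet> (B *v y) = c * (s\<^sup>2 * (norm y)\<^sup>2 - (norm (A *v y))\<^sup>2)" for y
    by (simp add: Bv inner_diff_right quadratic_form_gram dot_square_norm)
  have "0 \<le> y \<bullet> (B *v y)" for y
  proof (cases "y = 0")
    case False
    define z where "z = (1 / norm y) *\<^sub>R y"
    have z: "norm z = 1" "y = norm y *\<^sub>R z" using False by (simp_all add: z_def)
    have "A *v y = norm y *\<^sub>R (A *v z)"
      by (subst z(2)) (rule matrix_vector_mult_scaleR)
    then have "y \<bullet> (B *v y) = (norm y)\<^sup>2 * (c * s\<^sup>2 - c * (norm (A *v z))\<^sup>2)"
      unfolding q by (simp add: power_mult_distrib algebra_simps)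
    then show ?thesis using ext[OF z(1)] by (simp add: s_def)
  qed simp
  moreover have "x \<bullet> (B *v x) = 0" by (simp add: q x s_def)
  ultimately have "B *v x = 0" by (intro psd_form_zero symB)
  then have "(transpose A ** A) *v x = s\<^sup>2 *\<^sub>R x" using c by (auto simp: Bv)
  then show ?thesis using x by (auto simp: singular_values_def s_def intro!: exI[of _ x])
qed

lemma continuous_on_norm_mult_vec: "continuous_on X (\<lambda>x. norm ((A :: real ^ 'b ^ 'a) *v x))"
  by (intro continuous_intros linear_continuous_on matrix_vector_mul_bounded_linear)

text \<open>The maximum over the compact unit sphere is attained and is a singular value;
  homogeneity extends the bound to all vectors. The next lemma does the same with the
  minimum.\<close>

lemma ex_singular_value_ge:
  obtains s where "s \<in> singular_values (A :: real ^ 'b ^ 'a)" "\<And>x. norm (A *v x) \<le> s * norm x"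
proof -
  have ne: "sphere (0 :: real ^ 'b) 1 \<noteq> {}" by simp
  obtain x where x: "x \<in> sphere 0 1" and max: "\<And>y. y \<in> sphere 0 1 \<Longrightarrow> norm (A *v y) \<le> norm (A *v x)"
    using continuous_attains_sup[OF compact_sphere ne continuous_on_norm_mult_vec[of _ A]] by auto
  have "norm (A *v x) \<in> singular_values A"
    by (rule sphere_extremal_singular_value[where c = 1]) (use x max in \<open>auto intro!: power_mono\<close>)
  moreover have "norm (A *v y) \<le> norm (A *v x) * norm y" for y
  proof (cases "y = 0")
    case False
    then show ?thesis using max[of "(1 / norm y) *\<^sub>R y"]
      by (simp add: matrix_vector_mult_scaleR field_simps)
  qed simp
  ultimately show ?thesis using that by blast
qed

lemma ex_singular_value_le:
  obtains s where "s \<in> singular_values (A :: real ^ 'b ^ 'a)" "\<And>x. s * norm x \<le> norm (A *v x)"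
proof -
  have ne: "sphere (0 :: real ^ 'b) 1 \<noteq> {}" by simp
  obtain x where x: "x \<in> sphere 0 1" and min: "\<And>y. y \<in> sphere 0 1 \<Longrightarrow> norm (A *v x) \<le> norm (A *v y)"
    using continuous_attains_inf[OF compact_sphere ne continuous_on_norm_mult_vec[of _ A]] by auto
  have "norm (A *v x) \<in> singular_values A"
    by (rule sphere_extremal_singular_value[where c = "-1"]) (use x min in \<open>auto intro!: power_mono\<close>)
  moreover have "norm (A *v x) * norm y \<le> norm (A *v y)" for y
  proof (cases "y = 0")
    case False
    then show ?thesis using min[of "(1 / norm y) *\<^sub>R y"]
      by (simp add: matrix_vector_mult_scaleR field_simps)
  qed simp
  ultimately show ?thesis using that by blast
qed

lemma spectral_norm_le_sigma_max: "spectral_norm (A :: real ^ 'b ^ 'a) \<le> sigma_max A"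
proof -
  obtain s where s: "s \<in> singular_values A" "\<And>x. norm (A *v x) \<le> s * norm x"
    using ex_singular_value_ge[of A] by blast
  have "spectral_norm A \<le> s" using s(2) by (rule onorm_le)
  also have "s \<le> sigma_max A"
    unfolding sigma_max_def by (rule Max_ge[OF finite_singular_values s(1)])
  finally show ?thesis .
qed

lemma sigma_min_le: "sigma_min (A :: real ^ 'b ^ 'a) * norm x \<le> norm (A *v x)"
proof -
  obtain s where s: "s \<in> singular_values A" "\<And>x. s * norm x \<le> norm (A *v x)"
    using ex_singular_value_le[of A] by blast
  have "sigma_min A \<le> s"
    unfolding sigma_min_def by (rule Min_le[OF finite_singular_values s(1)])
  then have "sigma_min A * norm x \<le> s * norm x" by (intro mult_right_mono) auto
  also have "\<dots> \<le> norm (A *v x)" by (rule s(2))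
  finally show ?thesis .
qed

text \<open>The minimum is attained, so if it were 0 its eigenvector would lie in the kernel of
  \<open>A\<close>, against injectivity.\<close>

lemma sigma_min_pos:
  fixes A :: "real ^ 'b ^ 'a"
  assumes "rank A = CARD('b)"
  shows "0 < sigma_min A"
proof -
  have "singular_values A \<noteq> {}" using ex_singular_value_ge[of A] by blast
  then have "sigma_min A \<in> singular_values A"
    unfolding sigma_min_def by (intro Min_in finite_singular_values)
  then obtain x where x: "0 \<le> sigma_min A" "x \<noteq> 0"
    "(transpose A ** A) *v x = (sigma_min A)\<^sup>2 *\<^sub>R x"
    by (auto simp: singular_values_def)
  have "A *v x \<noteq> 0"
    using assms x(2) unfolding full_rank_injective by (metis injD matrix_vector_mult_0_right)
  moreover have "(norm (A *v x))\<^sup>2 = (sigma_min A)\<^sup>2 * (norm x)\<^sup>2"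
    by (simp add: quadratic_form_gram[symmetric] x(3) dot_square_norm)
  ultimately show ?thesis using x(1) by (cases "sigma_min A = 0") auto
qed

lemma sigma_min_le_spectral_norm: "sigma_min (A :: real ^ 'b ^ 'a) \<le> spectral_norm A"
  using sigma_min_le[of A "axis undefined 1"] norm_mult_vec_le_onorm[of A "axis undefined 1"]
  by (simp add: norm_axis_1)

section \<open>Rounding errors of the subroutines\<close>

lemma gam_nonneg:
  assumes "0 \<le> u" "real k * u \<le> \<theta>" "\<theta> < 1"
  shows "0 \<le> gam u k"
  using assms by (simp add: gam_def)

lemma gam_le:
  assumes "0 \<le> u" "real k * u \<le> \<theta>" "\<theta> < 1"
  shows "gam u k \<le> real k * u / (1 - \<theta>)"
  unfolding gam_def using assms by (intro divide_left_mono mult_pos_pos) auto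

lemma norm_le_abs_product:
  fixes A :: "real ^ 'k ^ 'a" and B :: "real ^ 'b ^ 'k"
  assumes "\<bar>D\<bar> \<le> g *\<^sub>R (\<bar>A\<bar> ** \<bar>B\<bar>)" "0 \<le> g"
  shows "norm D \<le> g * norm A * norm B"
proof -
  have "norm D \<le> norm (g *\<^sub>R (\<bar>A\<bar> ** \<bar>B\<bar>))" by (rule norm_le_entrywise[OF assms(1)])
  also have "\<dots> \<le> g * (norm \<bar>A\<bar> * norm \<bar>B\<bar>)"
    using assms(2) by (simp add: mult_left_mono norm_matrix_mult_le)
  finally show ?thesis by (simp add: norm_abs_matrix)
qed

lemma fl_matmul_error:
  fixes A :: "real ^ 'k ^ 'a" and B :: "real ^ 'b ^ 'k"
  assumes "fl_matmul u A B C" "0 \<le> gam u CARD('k)"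
  shows "norm (C - A ** B) \<le> gam u CARD('k) * norm A * norm B"
  using assms unfolding fl_matmul_def by (auto intro: norm_le_abs_product)

text \<open>The columnwise errors add up in squares to a Frobenius bound. The orthonormal factor
  preserves norms, so it disappears and \<open>R\<close> is comparable with \<open>W + E\<close>
  vector by vector.\<close>

lemma fl_householder_R_error:
  fixes W :: "real ^ ('m :: {finite, linorder}) ^ 'p"
  assumes "fl_householder_R u W R" "0 \<le> gam u (29 * CARD('p) * CARD('m))"
  obtains E where "norm E \<le> gam u (29 * CARD('p) * CARD('m)) * norm W"
    and "\<And>x. norm (R *v x) = norm ((W + E) *v x)"
proof -
  let ?g = "gam u (29 * CARD('p) * CARD('m))"
  obtain Qt E where QE: "transpose Qt ** Qt = mat 1" "W + E = Qt ** R"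
    "\<And>j. norm (column j E) \<le> ?g * norm (column j W)"
    using assms(1) unfolding fl_householder_R_def by blast
  have "(norm E)\<^sup>2 \<le> (\<Sum>j\<in>UNIV. (?g * norm (column j W))\<^sup>2)"
    unfolding norm_matrix_sq_columns by (intro sum_mono power_mono QE) simp
  also have "\<dots> = (?g * norm W)\<^sup>2"
    by (simp add: norm_matrix_sq_columns power_mult_distrib sum_distrib_left)
  finally have "norm E \<le> ?g * norm W" by (rule power2_le_imp_le) (simp add: assms)
  moreover have "norm (R *v x) = norm ((W + E) *v x)" for x
    by (simp add: QE(2) matrix_vector_mul_assoc[symmetric] orthonormal_columns_norm[OF QE(1)])
  ultimately show ?thesis using that by blast
qed

text \<open>Each row has its own perturbation \<open>D\<close>, but the corresponding residual row
  is just that row of \<open>Q\<close> times \<open>D\<close>. Summing squares over the rows gives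
  one residual matrix.\<close>

lemma fl_solve_rows_error:
  fixes X Q :: "real ^ ('m :: {finite, linorder}) ^ 'n"
  assumes "fl_solve_rows u R X Q" "0 \<le> gam u CARD('m)"
  shows "norm (X - Q ** R) \<le> gam u CARD('m) * norm Q * norm R"
proof -
  let ?g = "gam u CARD('m)"
  have r: "norm (row i (X - Q ** R)) \<le> ?g * norm (row i Q) * norm R" for i
  proof -
    obtain D where D: "row i Q v* (R + D) = row i X" "\<bar>D\<bar> \<le> ?g *\<^sub>R \<bar>R\<bar>"
      using assms(1) unfolding fl_solve_rows_def by blast
    have "norm D \<le> norm (?g *\<^sub>R \<bar>R\<bar>)" by (rule norm_le_entrywise[OF D(2)])
    then have nD: "norm D \<le> ?g * norm R" using assms(2) by (simp add: norm_abs_matrix)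
    have "row i (X - Q ** R) = row i X - row i Q v* R"
      by (simp add: row_def vec_eq_iff matrix_matrix_mult_def vector_matrix_mult_def mult.commute)
    also have "\<dots> = row i Q v* D"
      unfolding D(1)[symmetric]
      by (simp add: vec_eq_iff vector_matrix_mult_def algebra_simps sum.distrib)
    finally have "row i (X - Q ** R) = transpose D *v row i Q" by simp
    then have "norm (row i (X - Q ** R)) \<le> norm D * norm (row i Q)"
      using norm_mult_vec_le[of "transpose D" "row i Q"] by (simp add: norm_transpose)
    also have "\<dots> \<le> ?g * norm R * norm (row i Q)" by (intro mult_right_mono nD) simp
    finally show ?thesis by (simp add: mult_ac)
  qed
  have "(norm (X - Q ** R))\<^sup>2 \<le> (\<Sum>i\<in>UNIV. (?g * norm (row i Q) * norm R)\<^sup>2)"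
    unfolding norm_matrix_sq_rows[of "X - Q ** R"] by (intro sum_mono power_mono r) simp
  also have "\<dots> = (?g * norm Q * norm R)\<^sup>2"
    by (simp add: norm_matrix_sq_rows[of Q] power_mult_distrib sum_distrib_left sum_distrib_right)
  finally show ?thesis by (rule power2_le_imp_le) (simp add: assms)
qed

text \<open>The diagonal of the majorant consists of squared column norms, so the trace is bounded
  without the dimension factor that a passage through the norm of \<open>D\<close> would
  cost.\<close>

lemma trace_le_abs_gram:
  fixes A :: "real ^ 'b ^ 'a"
  assumes "\<bar>D\<bar> \<le> g *\<^sub>R (\<bar>transpose A\<bar> ** \<bar>A\<bar>)"
  shows "trace D \<le> g * (norm A)\<^sup>2"
proof -
  have "D $ i $ i \<le> g * (norm (column i A))\<^sup>2" for i
  proof -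
    have "D $ i $ i \<le> g * (\<Sum>k\<in>UNIV. \<bar>A $ k $ i\<bar> * \<bar>A $ k $ i\<bar>)"
      using assms unfolding less_eq_vec_def abs_vec_def matrix_matrix_mult_def transpose_def
      by (simp del: abs_mult_self_eq add: abs_le_iff)
    then show ?thesis
      by (simp add: norm_vec_def L2_set_def column_def sum_nonneg power2_eq_square)
  qed
  then show ?thesis
    unfolding trace_def norm_matrix_sq_columns sum_distrib_left by (rule sum_mono)
qed

lemma trace_gram: "trace (transpose A ** A) = (norm (A :: real ^ 'b ^ 'a))\<^sup>2"
  unfolding norm_matrix_sq_columns
  by (simp add: trace_def norm_vec_def L2_set_def column_def matrix_matrix_mult_def transpose_def
      sum_nonneg power2_eq_square)

text \<open>The two Gram matrices differ by the sum of the product error and the Cholesky error. The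
  first claim evaluates this at a vector, the second takes traces; the latter bounds
  \<open>norm R\<close> by \<open>norm X\<close>, once the small multiple of \<open>norm R\<close>
  squared is absorbed.\<close>

lemma fl_cholesky_gram_error:
  fixes X :: "real ^ ('m :: {finite, linorder}) ^ 'n"
  assumes "fl_matmul u (transpose X) X G" "fl_cholesky u G R"
    and g: "0 \<le> gam u CARD('n)" "0 \<le> gam u (CARD('m) + 1)"
  shows "\<bar>(norm (R *v x))\<^sup>2 - (norm (X *v x))\<^sup>2\<bar>
      \<le> (gam u CARD('n) * (norm X)\<^sup>2 + gam u (CARD('m) + 1) * (norm R)\<^sup>2) * (norm x)\<^sup>2"
    and "(norm R)\<^sup>2 \<le> (norm X)\<^sup>2 + gam u CARD('n) * (norm X)\<^sup>2 + gam u (CARD('m) + 1) * (norm R)\<^sup>2"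
proof -
  obtain D where D: "G = transpose X ** X + D" "\<bar>D\<bar> \<le> gam u CARD('n) *\<^sub>R (\<bar>transpose X\<bar> ** \<bar>X\<bar>)"
    using assms(1) unfolding fl_matmul_def by blast
  obtain E where E: "transpose R ** R = G + E"
    "\<bar>E\<bar> \<le> gam u (CARD('m) + 1) *\<^sub>R (\<bar>transpose R\<bar> ** \<bar>R\<bar>)"
    using assms(2) unfolding fl_cholesky_def by blast
  have eq: "transpose R ** R = transpose X ** X + (D + E)" using D(1) E(1) by simp
  have "norm (D + E) \<le> norm D + norm E" by (rule norm_triangle_ineq)
  also have "\<dots> \<le> gam u CARD('n) * (norm X)\<^sup>2 + gam u (CARD('m) + 1) * (norm R)\<^sup>2"
    using norm_le_abs_product[OF D(2) g(1)] norm_le_abs_product[OF E(2) g(2)]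
    by (simp add: norm_transpose power2_eq_square mult_ac)
  finally have nDE: "norm (D + E) \<le> \<dots>" .
  have "(norm (R *v x))\<^sup>2 - (norm (X *v x))\<^sup>2 = x \<bullet> ((D + E) *v x)"
    unfolding quadratic_form_gram[symmetric] eq
    by (simp add: matrix_vector_mult_add_rdistrib inner_add_right)
  also have "\<bar>\<dots>\<bar> \<le> norm x * norm ((D + E) *v x)" by (rule Cauchy_Schwarz_ineq2)
  also have "\<dots> \<le> norm x * (norm (D + E) * norm x)"
    by (intro mult_left_mono norm_mult_vec_le) simp
  also have "\<dots> = norm (D + E) * (norm x)\<^sup>2" by (simp add: power2_eq_square)
  also have "\<dots> \<le> (gam u CARD('n) * (norm X)\<^sup>2 + gam u (CARD('m) + 1) * (norm R)\<^sup>2) * (norm x)\<^sup>2"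
    by (intro mult_right_mono nDE) simp
  finally show "\<bar>(norm (R *v x))\<^sup>2 - (norm (X *v x))\<^sup>2\<bar>
      \<le> (gam u CARD('n) * (norm X)\<^sup>2 + gam u (CARD('m) + 1) * (norm R)\<^sup>2) * (norm x)\<^sup>2" .
  have "(norm R)\<^sup>2 = (norm X)\<^sup>2 + trace D + trace E"
    by (simp add: trace_gram[symmetric] eq trace_add)
  then show "(norm R)\<^sup>2 \<le> (norm X)\<^sup>2 + gam u CARD('n) * (norm X)\<^sup>2 + gam u (CARD('m) + 1) * (norm R)\<^sup>2"
    using trace_le_abs_gram[OF D(2)] trace_le_abs_gram[OF E(2)] by linarith
qed

section \<open>Error analysis\<close>

text \<open>The scalar consequences of \<delta> \<le> 1. Here \<open>A\<close> and \<open>B\<close>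
  stand for the roots of 1 - \<epsilon> and 1 + \<epsilon>, \<open>s\<close> for the Frobenius norm
  of S, \<open>v\<close> and \<open>w\<close> for the norm and smallest singular value of V, and
  \<open>D\<close> for \<delta>. The hypothesis \<open>key\<close> is the definition of \<delta>
  with denominators cleared; \<open>a\<close>, \<open>b\<close>, \<open>c\<close> are its three
  summands.\<close>

lemma roundoff_bounds:
  fixes m n p u A B s v w D :: real
  assumes m: "2 \<le> m" "m \<le> p" and n: "0 \<le> n" and u: "0 < u" and A: "0 < A" "A \<le> 1" and B: "1 \<le> B"
    and w: "0 < w" "w \<le> v" and D: "D \<le> 1" and s: "sqrt m * A \<le> s"
    and key: "383 * (p * (m * sqrt m) + sqrt m * (p * sqrt p * B + n * s)) * u * v \<le> A * D * w"
  shows "n * m * u + 1.5 * (m * m * u) \<le> 1.07 / 383"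
    and "p * m * u \<le> 1 / 541"
    and "m * m * u * B * v \<le> A * D * w / 383"
    and "m * m * u * B \<le> A / 383"
    and "p * m * sqrt m * u * v + sqrt m * n * s * u * v \<le> A * D * w / 383"
    and "0 \<le> D"
proof -
  define a where "a = p * m * sqrt m * u"
  define b where "b = sqrt m * p * sqrt p * B * u"
  define c where "c = sqrt m * n * s * u"
  have s0: "0 \<le> s" using s A m by (smt (verit) mult_nonneg_nonneg real_sqrt_ge_zero)
  have sm: "1.4142 \<le> sqrt m" using m by (intro real_le_rsqrt) (simp add: power2_eq_square)
  have sqm: "sqrt m * sqrt m = m" using m by simp
  have pm: "sqrt m \<le> sqrt p" "0 \<le> sqrt m" using m by auto
  have nn: "0 \<le> a" "0 \<le> b" "0 \<le> c"
    unfolding a_def b_def c_def using m n u B s0 by auto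
  have v: "v > 0" using w by simp
  have abc: "383 * (a * v + b * v + c * v) \<le> A * D * w"
    using key by (simp add: a_def b_def c_def algebra_simps)
  have "0 \<le> 383 * (a * v + b * v + c * v)" using nn v by simp
  with abc have "0 \<le> A * D * w" by simp
  then show D0: "0 \<le> D" using A w by (simp add: zero_le_mult_iff)
  \<comment> \<open>Since \<open>D \<le> 1\<close> and \<open>w \<le> v\<close>, the factor
    \<open>v\<close> cancels, leaving a bound on \<open>a + b + c\<close> that is free of the
    condition number.\<close>
  have "A * D * w \<le> A * w" using A D w D0 by (simp add: mult_left_le)
  also have "\<dots> \<le> A * v" using A w by simp
  finally have "383 * (a + b + c) * v \<le> A * v" using abc by (simp add: algebra_simps)
  then have abcA: "383 * (a + b + c) \<le> A" using v by simp
  have a_ge: "1.4142 * (p * m * u) \<le> a"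
    using mult_left_mono[OF sm, of "p * m * u"] m u by (simp add: a_def mult_ac)
  have pmm: "m * m * u \<le> p * m * u" using m u by simp
  \<comment> \<open>383 times 1.4142 exceeds 541.\<close>
  show "p * m * u \<le> 1 / 541" using a_ge abcA nn A by simp
  have "m * m * u * B \<le> b"
  proof -
    have "sqrt m * (m * sqrt m) * (B * u) \<le> sqrt m * (p * sqrt p) * (B * u)"
      using m pm B u by (intro mult_right_mono mult_left_mono mult_mono) auto
    moreover have "sqrt m * (m * sqrt m) * (B * u) = m * m * u * B" using sqm by (simp add: mult_ac)
    ultimately show ?thesis using m by (simp add: b_def mult_ac)
  qed
  then have bv: "m * m * u * B * v \<le> b * v" and "m * m * u * B \<le> b" using v by auto
  then show "m * m * u * B \<le> A / 383" using abcA nn by simp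
  have nnv: "0 \<le> a * v" "0 \<le> b * v" "0 \<le> c * v" using nn v by auto
  show "m * m * u * B * v \<le> A * D * w / 383" using bv abc nnv by simp
  have "p * m * sqrt m * u * v + sqrt m * n * s * u * v = a * v + c * v"
    by (simp add: a_def c_def)
  then show "p * m * sqrt m * u * v + sqrt m * n * s * u * v \<le> A * D * w / 383"
    using abc nnv by simp
  \<comment> \<open>The lower bound on \<open>s\<close> brings in a factor \<open>A\<close> that
    matches the one on the right of \<open>abcA\<close>, so that \<open>A\<close> cancels as
    well.\<close>
  have "sqrt m * (sqrt m * A) * (n * u) \<le> sqrt m * s * (n * u)"
    using s m n u by (intro mult_right_mono mult_left_mono) auto
  then have "n * m * u * A \<le> c" using sqm by (simp add: c_def mult_ac)
  moreover have "m * m * u * A \<le> m * m * u" using A u m by (simp add: mult_left_le)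
  ultimately have "383 * (n * m * u + 1.4142 * (m * m * u)) * A \<le> 1 * A"
    using abcA nn a_ge pmm by (simp add: algebra_simps)
  then have "383 * (n * m * u + 1.4142 * (m * m * u)) \<le> 1" using A by simp
  moreover have "0 \<le> n * m * u" using n m u by simp
  \<comment> \<open>1.5 / 1.4142 is below 1.07.\<close>
  ultimately show "n * m * u + 1.5 * (m * m * u) \<le> 1.07 / 383" by simp
qed

text \<open>Writing an arbitrary vector as \<open>R *v x\<close> replaces the use of an inverse of
  \<open>R\<close>.\<close>

lemma matrix_surj_if_bounded_below:
  fixes R :: "real ^ 'm ^ 'm"
  assumes "0 < l" "\<And>x. l * norm x \<le> norm (R *v x)"
  obtains x where "R *v x = y"
proof -
  have "x = 0" if "R *v x = 0" for x
    using assms(2)[of x] that assms(1) by (simp add: mult_le_0_iff)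
  then have "inj ((*v) R)"
    by (simp add: linear_injective_0[OF matrix_vector_mul_linear])
  then have "surj ((*v) R)" by (intro linear_injective_imp_surjective matrix_vector_mul_linear) simp_all
  then show ?thesis using that by (metis surjD)
qed

section \<open>Stability of the two QR steps\<close>

lemma mult_vec_split: "(A ** B) *v x = A *v (B *v (x :: real ^ 'c))" for A :: "real ^ 'b ^ 'a"
  by (simp add: matrix_vector_mul_assoc)

text \<open>The errors of the sketch product and of the Householder step together perturb S V by at
  most 0.1134 times its smallest singular value, so \<open>R\<close> distorts S V by a fixed factor
  only. The residual of the triangular solve is small relative to \<open>R\<close> and transfers
  this to \<open>Q\<close>.\<close>

lemma fl_randQR_bounds:
  fixes S :: "real ^ 'n ^ 'p" and V Q :: "real ^ ('m :: {finite, linorder}) ^ 'n"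
  assumes V: "\<And>x. w * norm x \<le> norm (V *v x)" "\<And>x. norm (V *v x) \<le> v * norm x"
    and S: "\<And>x. A * norm (V *v x) \<le> norm (S *v (V *v x))"
      "\<And>x. norm (S *v (V *v x)) \<le> B * norm (V *v x)"
    and A: "0 < A" "A \<le> 1" and B: "1 \<le> B" "B \<le> 1.4143" "B \<le> 25 / 3 * A"
    and w: "0 < w" "w \<le> v" and m: "2 \<le> CARD('m)" "CARD('m) \<le> CARD('p)"
    and u: "0 < u" and D: "D \<le> 1" and nS: "sqrt (real CARD('m)) * A \<le> norm S"
    and key: "383 * (real CARD('p) * (real CARD('m) * sqrt (real CARD('m)))
        + sqrt (real CARD('m)) * (real CARD('p) * sqrt (real CARD('p)) * B
                                  + real CARD('n) * norm S)) * u * v \<le> A * D * w"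
    and fl: "fl_randQR u S V Q R"
  shows "norm (R *v x) \<le> 1.114 * B * v * norm x"
    and "norm (Q *v x) \<le> 1.132 / A * norm x"
    and "0.866 / B * norm x \<le> norm (Q *v x)"
    and "norm (V - Q ** R) \<le> D * w / 10"
proof -
  let ?m = "real CARD('m)" and ?n = "real CARD('n)" and ?p = "real CARD('p)"
  let ?s = "norm S"
  have m2: "2 \<le> ?m" "?m \<le> ?p" using m by auto
  note rb = roundoff_bounds[OF m2 of_nat_0_le_iff u A B(1) w D nS key]
  have v: "0 < v" using w by simp
  have n1: "1 \<le> ?n" by (simp add: Suc_leI)
  have nu: "?n * u \<le> 0.0014"
  proof -
    have "2 * (?n * u) \<le> ?m * (?n * u)" using m2 u by (intro mult_right_mono) auto
    moreover have "0 \<le> ?m * ?m * u" using u by simp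
    ultimately show ?thesis using rb(1) by (simp add: mult_ac)
  qed
  have mu: "?m * u \<le> 0.0014"
  proof -
    have "2 * (?m * u) \<le> ?m * (?m * u)" using m2 u by (intro mult_right_mono) auto
    moreover have "0 \<le> ?n * ?m * u" using u by simp
    ultimately show ?thesis using rb(1) by (simp add: mult_ac)
  qed
  obtain W where W: "fl_matmul u S V W" "fl_householder_R u W R" "fl_solve_rows u R V Q"
    using fl unfolding fl_randQR_def by blast
  \<comment> \<open>29 / 541 is below 0.0537.\<close>
  have pmu: "real (29 * CARD('p) * CARD('m)) * u \<le> 0.0537" using rb(2) by simp
  define gn gm g where "gn = gam u CARD('n)" and "gm = gam u CARD('m)"
    and "g = gam u (29 * CARD('p) * CARD('m))"
  have gn: "0 \<le> gn" "gn \<le> 1.002 * (?n * u)"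
    using gam_nonneg[OF _ nu] gam_le[OF _ nu] u by (auto simp: gn_def)
  have gm: "0 \<le> gm" "gm \<le> 1.002 * (?m * u)"
    using gam_nonneg[OF _ mu] gam_le[OF _ mu] u by (auto simp: gm_def)
  have g: "0 \<le> g" "g \<le> 30.65 * (?p * ?m * u)"
    using gam_nonneg[OF _ pmu] gam_le[OF _ pmu] u by (auto simp: g_def)
  have g': "g \<le> 0.0567" using g rb(2) by simp
  obtain E2 where E2: "norm E2 \<le> g * norm W" "\<And>x. norm (R *v x) = norm ((W + E2) *v x)"
    using fl_householder_R_error[OF W(2)] g(1) unfolding g_def by metis
  \<comment> \<open>\<open>cx\<close> measures the error of the sketch product and \<open>ax\<close>
    the main part of the Householder error; \<open>rb(5)\<close> bounds their sum.\<close>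
  define ax cx where "ax = ?p * ?m * sqrt ?m * u * v" and "cx = sqrt ?m * ?n * ?s * u * v"
  have nn: "0 \<le> ax" "0 \<le> cx" using u v by (auto simp: ax_def cx_def)
  have nV: "norm V \<le> sqrt ?m * v" by (rule frobenius_le_op[OF V(2)]) (use v in simp)
  have E1: "norm (W - S ** V) \<le> 1.002 * cx"
  proof -
    have "norm (W - S ** V) \<le> gn * ?s * norm V"
      using fl_matmul_error[OF W(1)] gn(1) by (simp add: gn_def)
    also have "\<dots> \<le> 1.002 * (?n * u) * ?s * (sqrt ?m * v)"
      using gn nV u by (intro mult_mono) auto
    finally show ?thesis by (simp add: cx_def mult_ac)
  qed
  have SVop: "norm ((S ** V) *v x) \<le> B * v * norm x" for x
  proof -
    have "norm ((S ** V) *v x) \<le> B * norm (V *v x)" by (simp add: mult_vec_split S)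
    also have "\<dots> \<le> B * (v * norm x)" using B V by (intro mult_left_mono) auto
    finally show ?thesis by (simp add: mult_ac)
  qed
  have "norm (S ** V) \<le> sqrt ?m * (B * v)" by (rule frobenius_le_op[OF SVop]) (use B v in simp)
  then have nW: "norm W \<le> sqrt ?m * (B * v) + 1.002 * cx"
    using norm_triangle_ineq[of "S ** V" "W - S ** V"] E1 by simp
  have "g * (sqrt ?m * (B * v)) \<le> 30.65 * (?p * ?m * u) * (sqrt ?m * (1.4143 * v))"
    using g B v u by (intro mult_mono mult_nonneg_nonneg) auto
  then have gB: "g * (sqrt ?m * (B * v)) \<le> 43.35 * ax"
    using nn by (simp add: ax_def mult_ac)
  have gc: "g * (1.002 * cx) \<le> 0.057 * cx"
    using mult_right_mono[OF g', of "1.002 * cx"] nn by simp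
  have nE2: "norm E2 \<le> 43.35 * ax + 0.057 * cx"
    using E2(1) mult_left_mono[OF nW g(1)] gB gc unfolding distrib_left by linarith
  define E where "E = (W - S ** V) + E2"
  have E_ac: "norm E \<le> 43.4 * (ax + cx)"
    using norm_triangle_ineq[of "W - S ** V" E2] nE2 E1 nn by (simp add: E_def)
  \<comment> \<open>This is where 383 pays off: 43.4 / 383 is below 0.1134.\<close>
  have "e \<le> 0.1134 * d" if "e \<le> 43.4 * (a + c)" "a + c \<le> d / 383" "0 \<le> d" for a c d e :: real
    using that by simp
  from this[OF E_ac rb(5)[folded ax_def cx_def]] have nE: "norm E \<le> 0.1134 * (A * D * w)"
    using A w rb(6) by simp
  have ADw: "A * D * w \<le> A * w" using A D w rb(6) by (simp add: mult_left_le)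
  \<comment> \<open>The chain through \<open>w * norm z\<close>, \<open>norm (V *v z)\<close> and
    the embedding makes an absolute error relative to the sketched vector.\<close>
  have Ez: "norm (E *v z) \<le> 0.1134 * norm (S *v (V *v z))" for z
  proof -
    have "norm (E *v z) \<le> norm E * norm z" by (rule norm_mult_vec_le)
    also have "\<dots> \<le> 0.1134 * (A * w) * norm z" using nE ADw by (intro mult_right_mono) auto
    also have "\<dots> \<le> 0.1134 * (A * norm (V *v z))" using V(1)[of z] A by (simp add: mult.assoc)
    also have "\<dots> \<le> 0.1134 * norm (S *v (V *v z))" using S(1)[of z] by simp
    finally show ?thesis .
  qed
  have Rz: "norm (R *v z) = norm (S *v (V *v z) + E *v z)" for z
  proof -
    have "W + E2 = S ** V + E" by (simp add: E_def)
    then show ?thesis by (simp add: E2(2) matrix_vector_mult_add_rdistrib mult_vec_split)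
  qed
  have R_up: "norm (R *v z) \<le> 1.1134 * norm (S *v (V *v z))" for z
    using Ez[of z] norm_triangle_ineq[of "S *v (V *v z)" "E *v z"] by (simp add: Rz)
  have R_lo: "0.8866 * norm (S *v (V *v z)) \<le> norm (R *v z)" for z
    using Ez[of z] norm_diff_ineq[of "S *v (V *v z)" "E *v z"] by (simp add: Rz)
  have Rop: "norm (R *v z) \<le> 1.1134 * (B * v) * norm z" for z
    using R_up[of z] SVop[of z] by (simp add: mult_vec_split)
  have BvX: "0 \<le> B * v * norm x" using B v by simp
  show "norm (R *v x) \<le> 1.114 * B * v * norm x" using Rop[of x] BvX by simp
  have AVR: "A * norm (V *v z) \<le> 1.12791 * norm (R *v z)" for z
  proof -
    have "a \<le> 1.12791 * b" if "0.8866 * a \<le> b" "0 \<le> b" for a b :: real using that by simp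
    from this[OF R_lo norm_ge_zero] show ?thesis using S(1) order_trans by blast
  qed
  have AwR: "A * w * norm z \<le> 1.12791 * norm (R *v z)" for z
  proof -
    have "A * (w * norm z) \<le> A * norm (V *v z)" using V(1) A by simp
    then show ?thesis using AVR[of z] by (simp add: mult.assoc)
  qed
  have Rsurj: "\<exists>z. R *v z = y" for y
  proof -
    have "A * w / 1.12791 * norm z \<le> norm (R *v z)" for z using AwR[of z] by simp
    moreover have "0 < A * w / 1.12791" using A w by simp
    ultimately show ?thesis using matrix_surj_if_bounded_below by metis
  qed
  define q where "q = spectral_norm Q"
  have q0: "0 \<le> q" by (simp add: q_def onorm_pos_le)
  have Qq: "norm (Q *v y) \<le> q * norm y" for y unfolding q_def by (rule norm_mult_vec_le_onorm)
  define E3 where "E3 = V - Q ** R"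
  \<comment> \<open>The bound contains the still unknown norm \<open>q\<close> of \<open>Q\<close>.
    The factor \<open>D\<close> is kept because the last claim is proportional to it.\<close>
  have nE3: "norm E3 \<le> 0.00292 * (A * D * w) * q"
  proof -
    have nQ: "norm Q \<le> sqrt ?m * q" by (rule frobenius_le_op[OF Qq q0])
    have nR: "norm R \<le> sqrt ?m * (1.1134 * (B * v))"
      by (rule frobenius_le_op[OF Rop]) (use B v in simp)
    have "norm E3 \<le> gm * norm Q * norm R"
      using fl_solve_rows_error[OF W(3)] gm(1) by (simp add: gm_def E3_def)
    also have "\<dots> \<le> 1.002 * (?m * u) * (sqrt ?m * q) * (sqrt ?m * (1.1134 * (B * v)))"
      using gm nQ nR q0 u by (intro mult_mono) auto
    also have "\<dots> = 1.002 * 1.1134 * (?m * u) * (sqrt ?m * sqrt ?m) * B * v * q" by simp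
    also have "\<dots> = 1.002 * 1.1134 * (?m * ?m * u * B * v) * q" by (simp del: mult_eq_0_iff)
    also have "\<dots> \<le> 1.002 * 1.1134 * (A * D * w / 383) * q"
      using rb(3) q0 by (intro mult_right_mono mult_left_mono) auto
    also have "\<dots> \<le> 0.00292 * (A * D * w) * q"
      using q0 A w rb(6) by (auto intro!: mult_right_mono)
    finally show ?thesis .
  qed
  have E3z: "norm (E3 *v z) \<le> 0.0033 * q * norm (R *v z)" for z
  proof -
    have "norm (E3 *v z) \<le> norm E3 * norm z" by (rule norm_mult_vec_le)
    also have "\<dots> \<le> 0.00292 * (A * w) * q * norm z"
      using nE3 mult_right_mono[OF ADw, of "0.00292 * q"] q0
      by (intro mult_right_mono) (auto simp: mult_ac)
    also have "\<dots> = 0.00292 * q * (A * w * norm z)" by simp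
    also have "\<dots> \<le> 0.00292 * q * (1.12791 * norm (R *v z))"
      using q0 by (intro mult_left_mono AwR) auto
    also have "\<dots> \<le> 0.0033 * q * norm (R *v z)" using q0 by (auto intro!: mult_right_mono)
    finally show ?thesis .
  qed
  have QR: "Q *v (R *v z) = V *v z - E3 *v z" for z
    by (simp add: E3_def matrix_vector_mult_diff_rdistrib mult_vec_split)
  \<comment> \<open>Only the left \<open>q\<close> is unfolded; the right one is absorbed
    afterwards.\<close>
  have "q \<le> 1.12791 / A + 0.0033 * q"
    unfolding q_def[symmetric]
  proof (subst (1) q_def, rule onorm_le)
    fix y
    obtain z where z: "R *v z = y" using Rsurj by blast
    have "norm (V *v z) \<le> 1.12791 / A * norm y" using AVR[of z] A z by (simp add: field_simps)
    moreover have "norm (Q *v y) \<le> norm (V *v z) + norm (E3 *v z)"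
      using QR[of z] z norm_triangle_ineq4 by metis
    ultimately show "norm (Q *v y) \<le> (1.12791 / A + 0.0033 * q) * norm y"
      using E3z[of z] z by (simp add: distrib_right)
  qed
  then have "q \<le> 1.12791 / 0.9967 / A" by simp
  also have "\<dots> \<le> 1.132 / A" using A by (intro divide_right_mono) auto
  finally have q: "q \<le> 1.132 / A" .
  show "norm (Q *v x) \<le> 1.132 / A * norm x"
    using Qq[of x] mult_right_mono[OF q norm_ge_zero[of x]] by simp
  \<comment> \<open>The upper bound on \<open>q\<close> is of order 1 / \<open>A\<close>, but the
    lower bound on \<open>Q\<close> needs an error of order 1 / \<open>B\<close>. The limit 25 / 3
    on the ratio makes the exchange possible.\<close>
  have qB: "0.0033 * q \<le> 0.0312 / B"
  proof -
    have arith: "0.0033 * c \<le> 0.0312 * b"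
      if "a \<le> 25 / 3 * b" "c \<le> 1.132 * a" "0 \<le> b" for a b c :: real
      using that by simp
    have "1 / A \<le> 25 / 3 * (1 / B)" "q \<le> 1.132 * (1 / A)" "0 \<le> 1 / B"
      using A B q by (auto simp: field_simps)
    from arith[OF this] show ?thesis by simp
  qed
  show "0.866 / B * norm x \<le> norm (Q *v x)"
  proof -
    obtain z where z: "R *v z = x" using Rsurj by blast
    have x_le: "norm x \<le> 1.1134 * (B * norm (V *v z))" using R_up[of z] S(2)[of z] z by simp
    have arith: "0.898 * a \<le> b" if "a \<le> 1.1134 * b" "0 \<le> b" for a b :: real using that by simp
    have "0.898 * norm x \<le> B * norm (V *v z)" by (rule arith[OF x_le]) (use B in simp)
    then have 1: "0.898 / B * norm x \<le> norm (V *v z)" using B by (simp add: field_simps)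
    have 2: "norm (V *v z) - norm (E3 *v z) \<le> norm (Q *v x)"
      using QR[of z] z norm_triangle_ineq2 by metis
    have 3: "norm (E3 *v z) \<le> 0.0312 / B * norm x"
      using E3z[of z] z mult_right_mono[OF qB norm_ge_zero[of x]] by simp
    have "0.866 / B * norm x \<le> (0.898 / B - 0.0312 / B) * norm x"
      using B by (intro mult_right_mono) (auto simp: field_simps)
    then show ?thesis using 1 2 3 by (simp add: left_diff_distrib)
  qed
  have "0.00292 * (A * D * w) * q \<le> 0.00292 * (A * D * w) * (1.132 / A)"
    using A w rb(6) by (intro mult_left_mono q) auto
  with nE3 have "norm E3 \<le> 0.00292 * (A * D * w) * (1.132 / A)" by (rule order_trans)
  also have "\<dots> = 0.00292 * 1.132 * (D * w)" using A by simp
  also have "\<dots> \<le> D * w / 10" using w rb(6) by simp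
  finally show "norm (V - Q ** R) \<le> D * w / 10" by (simp add: E3_def)
qed

text \<open>With \<open>l\<close> and \<open>q\<close> enclosing the singular values of
  \<open>X\<close>, dividing the Gram error by \<open>l\<close> squared makes it relative to
  \<open>X\<close>, at the price of \<rho> squared. Then \<open>norm (R *v y)\<close>,
  \<open>norm (X *v y)\<close> and \<open>norm (Q *v (R *v y))\<close> agree up to small relative
  errors, and every vector is of the form \<open>R *v y\<close>.\<close>

lemma fl_cholQR_bounds:
  fixes X Q :: "real ^ ('m :: {finite, linorder}) ^ 'n" and l q \<rho> u :: real
  defines "t \<equiv> (real CARD('n) * real CARD('m) + real CARD('m) * (real CARD('m) + 1)) * u"
  assumes X: "\<And>x. l * norm x \<le> norm (X *v x)" "\<And>x. norm (X *v x) \<le> q * norm x"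
    and l: "0 < l" and q: "0 \<le> q" "q \<le> 1.31 * \<rho> * l" and \<rho>: "1 \<le> \<rho>" "\<rho> \<le> 25 / 3"
    and m: "2 \<le> CARD('m)" "CARD('m) \<le> CARD('n)" and u: "0 < u"
    and nmu: "real CARD('n) * real CARD('m) * u + 1.5 * (real CARD('m) * real CARD('m) * u) \<le> 1.07 / 383"
    and mu\<rho>: "real CARD('m) * real CARD('m) * u * \<rho> \<le> 1 / 383"
    and fl: "fl_cholQR u X Q R"
  shows "\<bar>(norm (Q *v x))\<^sup>2 - (norm x)\<^sup>2\<bar> \<le> 5.5 * t * \<rho>\<^sup>2 * (norm x)\<^sup>2"
    and "spectral_norm Q \<le> 1.25"
    and "norm R \<le> sqrt (real CARD('m)) * (1.0015 * q)"
    and "norm (X - Q ** R) \<le> 1.01 * (real CARD('m))\<^sup>2 * u * spectral_norm Q * q"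
proof -
  let ?m = "real CARD('m)" and ?n = "real CARD('n)"
  have m2: "2 \<le> ?m" "?m \<le> ?n" using m by auto
  have mm0: "0 \<le> ?m * ?m * u" "0 \<le> ?n * ?m * u" using u by auto
  have m_le: "2 * ?m * u \<le> ?m * ?m * u" using m2 u by simp
  have nu: "?n * u \<le> 0.0014"
  proof -
    have "2 * (?n * u) \<le> ?m * (?n * u)" using m2 u by (intro mult_right_mono) auto
    then show ?thesis using nmu mm0 by (simp add: mult_ac)
  qed
  \<comment> \<open>As m \<ge> 2, the term m u of \<open>t\<close> is at most half of m^2 u. This
    explains the weight 1.5 in \<open>nmu\<close>.\<close>
  have arith: "a \<le> 0.00094" "c + b + a \<le> 1.07 / 383"
    if "2 * a \<le> b" "c + 1.5 * b \<le> 1.07 / 383" "0 \<le> b" "0 \<le> c" for a b c :: real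
    using that by auto
  note arith = arith[OF m_le[unfolded mult.assoc[of 2]] nmu mm0]
  have mu: "?m * u \<le> 0.00094" by (rule arith)
  have t_alt: "t = ?n * ?m * u + ?m * ?m * u + ?m * u" by (simp add: t_def algebra_simps)
  have m1u: "real (CARD('m) + 1) * u \<le> 0.00141"
  proof -
    have "real (CARD('m) + 1) * u \<le> (1.5 * ?m) * u" using m2 u by (intro mult_right_mono) auto
    then show ?thesis using mu by simp
  qed
  have t: "0 \<le> t" "t \<le> 1.07 / 383" and mt: "2 * (?m * ?m * u) \<le> t"
  proof -
    show "0 \<le> t" using mm0 u by (simp add: t_alt)
    show "t \<le> 1.07 / 383" unfolding t_alt by (rule arith)
    have "?m * ?m * u \<le> ?n * ?m * u" "0 \<le> ?m * u" using m2 u by simp_all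
    then show "2 * (?m * ?m * u) \<le> t" unfolding t_alt by linarith
  qed
  obtain G where G: "fl_matmul u (transpose X) X G" "fl_cholesky u G R" "fl_solve_rows u R X Q"
    using fl unfolding fl_cholQR_def by blast
  define gn gm g1 where "gn = gam u CARD('n)" and "gm = gam u CARD('m)"
    and "g1 = gam u (CARD('m) + 1)"
  have gn: "0 \<le> gn" "gn \<le> 1.002 * (?n * u)" "gn \<le> 0.00141"
    using gam_nonneg[OF _ nu] gam_le[OF _ nu] u nu by (auto simp: gn_def)
  have gm: "0 \<le> gm" "gm \<le> 1.002 * (?m * u)"
    using gam_nonneg[OF _ mu] gam_le[OF _ mu] u by (auto simp: gm_def)
  have g1: "0 \<le> g1" "g1 \<le> 1.0015 * ((1 + ?m) * u)" "g1 \<le> 0.00142"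
    using gam_nonneg[OF _ m1u] gam_le[OF _ m1u] u m1u by (auto simp: g1_def)
  note ch = fl_cholesky_gram_error[OF G(1,2), folded gn_def g1_def, OF gn(1) g1(1)]
  define x2 r2 where "x2 = (norm X)\<^sup>2" and "r2 = (norm R)\<^sup>2"
  have nn: "0 \<le> x2" "0 \<le> r2" by (auto simp: x2_def r2_def)
  have "norm X \<le> sqrt ?m * q" by (rule frobenius_le_op[OF X(2) q(1)])
  then have "x2 \<le> (sqrt ?m * q)\<^sup>2" unfolding x2_def by (intro power_mono) auto
  then have x2: "x2 \<le> ?m * q\<^sup>2" by (simp add: power_mult_distrib)
  \<comment> \<open>The trace estimate is solved for \<open>r2\<close>.\<close>
  have "r2 \<le> x2 + gn * x2 + g1 * r2" using ch(2) by (simp add: x2_def r2_def)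
  also have "\<dots> \<le> x2 + 0.00141 * x2 + 0.00142 * r2"
    using gn g1 nn by (intro add_mono mult_right_mono) auto
  finally have "r2 \<le> 1.003 * x2" using nn by simp
  then have r2: "r2 \<le> 1.003 * (?m * q\<^sup>2)" using x2 by simp
  show nR: "norm R \<le> sqrt ?m * (1.0015 * q)"
  proof (rule power2_le_imp_le)
    have "(norm R)\<^sup>2 \<le> 1.003 * (?m * q\<^sup>2)" using r2 by (simp add: r2_def)
    also have "\<dots> \<le> 1.0015\<^sup>2 * (?m * q\<^sup>2)"
      by (intro mult_right_mono) (simp_all add: power2_eq_square)
    also have "\<dots> = (sqrt ?m)\<^sup>2 * (1.0015 * q)\<^sup>2"
      by (simp only: power_mult_distrib real_sqrt_pow2 of_nat_0_le_iff mult_ac)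
    also have "\<dots> = (sqrt ?m * (1.0015 * q))\<^sup>2" by (simp only: power_mult_distrib)
    finally show "(norm R)\<^sup>2 \<le> (sqrt ?m * (1.0015 * q))\<^sup>2" .
  qed (use q in simp)
  have q2: "q\<^sup>2 \<le> 1.7161 * (\<rho>\<^sup>2 * l\<^sup>2)"
  proof -
    have "q\<^sup>2 \<le> (1.31 * \<rho> * l)\<^sup>2" using q by (intro power_mono) auto
    then show ?thesis by (simp add: power_mult_distrib power_divide)
  qed
  \<comment> \<open>The relative size of the Gram error. The limits on \<open>t\<close> and \<rho>
    keep it below 0.19402, so \<open>1.727 * T\<close> stays below 0.3351 and \<open>R\<close>
    remains injective.\<close>
  define T where "T = t * \<rho>\<^sup>2"
  have "\<rho>\<^sup>2 \<le> (25 / 3)\<^sup>2" using \<rho> by (intro power_mono) auto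
  then have "T \<le> (1.07 / 383) * (625 / 9)"
    unfolding T_def using t by (intro mult_mono) (auto simp: power2_eq_square)
  then have T: "0 \<le> T" "T \<le> 0.19402" using t by (auto simp: T_def)
  \<comment> \<open>Rounding both coefficients up to 1.006 lets the two terms combine into
    \<open>t\<close>; 1.7161 is the square of 1.31.\<close>
  have gram: "gn * x2 + g1 * r2 \<le> 1.727 * T * l\<^sup>2"
  proof -
    have "gn * x2 + g1 * r2 \<le> 1.002 * (?n * u) * (?m * q\<^sup>2) + 1.0015 * ((1 + ?m) * u) * (1.003 * (?m * q\<^sup>2))"
      using gn g1 x2 r2 nn u by (intro add_mono mult_mono) auto
    also have "\<dots> \<le> 1.006 * (?n * u) * (?m * q\<^sup>2) + 1.006 * ((1 + ?m) * u) * (?m * q\<^sup>2)"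
    proof -
      have arith: "1.002 * a * c + 1.0015 * b * (1.003 * c) \<le> 1.006 * a * c + 1.006 * b * c"
        if "0 \<le> a * c" "0 \<le> b * c" for a b c :: real
        using that by (simp add: mult.assoc)
      show ?thesis by (rule arith) (use u in simp_all)
    qed
    also have "\<dots> = 1.006 * t * q\<^sup>2" by (simp add: t_def field_simps)
    also have "\<dots> \<le> 1.006 * t * (1.7161 * (\<rho>\<^sup>2 * l\<^sup>2))" using q2 t by (intro mult_left_mono) auto
    also have "\<dots> = 1.006 * 1.7161 * (T * l\<^sup>2)" by (simp add: T_def)
    also have "\<dots> \<le> 1.727 * T * l\<^sup>2" using T by simp
    finally show ?thesis .
  qed
  have d1: "\<bar>(norm (R *v y))\<^sup>2 - (norm (X *v y))\<^sup>2\<bar> \<le> 1.727 * T * (norm (X *v y))\<^sup>2" for y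
  proof -
    have "\<bar>(norm (R *v y))\<^sup>2 - (norm (X *v y))\<^sup>2\<bar> \<le> (gn * x2 + g1 * r2) * (norm y)\<^sup>2"
      using ch(1) by (simp add: x2_def r2_def)
    also have "\<dots> \<le> 1.727 * T * l\<^sup>2 * (norm y)\<^sup>2" by (intro mult_right_mono gram) simp
    also have "\<dots> = 1.727 * T * (l * norm y)\<^sup>2" by (simp add: power_mult_distrib)
    also have "\<dots> \<le> 1.727 * T * (norm (X *v y))\<^sup>2"
      using T l X(1) by (intro mult_left_mono power_mono) auto
    finally show ?thesis .
  qed
  have XR: "(norm (X *v y))\<^sup>2 \<le> 1.506 * (norm (R *v y))\<^sup>2" for y
  proof -
    have "1.727 * T * (norm (X *v y))\<^sup>2 \<le> 0.3351 * (norm (X *v y))\<^sup>2"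
      using T by (intro mult_right_mono) auto
    moreover have "a \<le> 1.506 * b" if "\<bar>b - a\<bar> \<le> c" "c \<le> 0.3351 * a" "0 \<le> b" for a b c :: real
      using that by (simp add: abs_le_iff)
    ultimately show ?thesis using d1[of y] zero_le_power2 by blast
  qed
  have XR1: "norm (X *v y) \<le> 1.2273 * norm (R *v y)" for y
  proof (rule power2_le_imp_le)
    have "1.506 * (norm (R *v y))\<^sup>2 \<le> 1.2273\<^sup>2 * (norm (R *v y))\<^sup>2"
      by (intro mult_right_mono) (simp_all add: power2_eq_square)
    with XR[of y] show "(norm (X *v y))\<^sup>2 \<le> (1.2273 * norm (R *v y))\<^sup>2"
      unfolding power_mult_distrib by (rule order_trans)
  qed simp
  have Rsurj: "\<exists>z. R *v z = y" for y
  proof -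
    have "l / 1.2273 * norm z \<le> norm (R *v z)" for z using XR1[of z] X(1)[of z] by simp
    moreover have "0 < l / 1.2273" using l by simp
    ultimately show ?thesis using matrix_surj_if_bounded_below by metis
  qed
  define z where "z = spectral_norm Q"
  have z0: "0 \<le> z" by (simp add: z_def onorm_pos_le)
  have Qz: "norm (Q *v y) \<le> z * norm y" for y unfolding z_def by (rule norm_mult_vec_le_onorm)
  define E where "E = X - Q ** R"
  have nE: "norm E \<le> 1.004 * (?m * ?m * u) * z * q"
  proof -
    have nQ: "norm Q \<le> sqrt ?m * z" by (rule frobenius_le_op[OF Qz z0])
    have "norm E \<le> gm * norm Q * norm R"
      using fl_solve_rows_error[OF G(3)] gm(1) by (simp add: gm_def E_def)
    also have "\<dots> \<le> 1.002 * (?m * u) * (sqrt ?m * z) * (sqrt ?m * (1.0015 * q))"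
      using gm nQ nR z0 u q by (intro mult_mono) auto
    also have "\<dots> = 1.002 * 1.0015 * (?m * u) * (sqrt ?m * sqrt ?m) * (z * q)" by simp
    also have "\<dots> = 1.002 * 1.0015 * ((?m * ?m * u) * (z * q))" by simp
    also have "\<dots> \<le> 1.004 * ((?m * ?m * u) * (z * q))"
      using z0 q mm0 by (intro mult_right_mono) auto
    finally show ?thesis by (simp add: mult_ac)
  qed
  note nE
  also have "\<dots> = 1.004 * ((?m * ?m * u) * z * q)" by simp
  also have "\<dots> \<le> 1.01 * ((?m * ?m * u) * z * q)"
    using z0 q by (intro mult_right_mono mult_nonneg_nonneg mm0) auto
  finally have "norm E \<le> 1.01 * ((?m * ?m * u) * z * q)" .
  then show "norm (X - Q ** R) \<le> 1.01 * ?m\<^sup>2 * u * spectral_norm Q * q"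
    by (simp add: E_def z_def power2_eq_square mult_ac)
  \<comment> \<open>The residual of the triangular solve relative to \<open>X\<close>. It costs only
    one factor \<rho>, since \<open>q\<close> enters linearly.\<close>
  define \<phi> where "\<phi> = 1.3153 * (?m * ?m * u * \<rho>) * z"
  have mu0: "0 \<le> ?m * ?m * u * \<rho>" using mm0 \<rho> by simp
  have \<phi>0: "0 \<le> \<phi>" using mu0 z0 by (simp add: \<phi>_def)
  have Ey: "norm (E *v y) \<le> \<phi> * norm (X *v y)" for y
  proof -
    have "norm (E *v y) \<le> norm E * norm y" by (rule norm_mult_vec_le)
    also have "\<dots> \<le> 1.004 * (?m * ?m * u) * z * q * norm y" by (intro mult_right_mono nE) simp
    also have "\<dots> \<le> 1.004 * (?m * ?m * u) * z * (1.31 * \<rho> * l) * norm y"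
      using q z0 mm0 by (intro mult_right_mono mult_left_mono) auto
    also have "\<dots> = 1.004 * 1.31 * ((?m * ?m * u * \<rho>) * z * (l * norm y))" by simp
    also have "\<dots> \<le> 1.3153 * ((?m * ?m * u * \<rho>) * z * (l * norm y))"
      using l by (intro mult_right_mono mult_nonneg_nonneg[OF mult_nonneg_nonneg[OF mu0 z0]]) auto
    also have "\<dots> = \<phi> * (l * norm y)" by (simp add: \<phi>_def)
    also have "\<dots> \<le> \<phi> * norm (X *v y)" using \<phi>0 X(1) by (intro mult_left_mono) auto
    finally show ?thesis .
  qed
  have QR: "Q *v (R *v y) = X *v y - E *v y" for y
    by (simp add: E_def matrix_vector_mult_diff_rdistrib mult_vec_split)
  \<comment> \<open>\<phi> is itself a small multiple of \<open>z\<close>, which is absorbed below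
    to give 1.233.\<close>
  have "z \<le> (1 + \<phi>) * 1.2273"
    unfolding z_def
  proof (rule onorm_le)
    fix y
    obtain w where w: "R *v w = y" using Rsurj by blast
    have "norm (Q *v y) \<le> norm (X *v w) + norm (E *v w)"
      using QR[of w] w norm_triangle_ineq4 by metis
    also have "\<dots> \<le> (1 + \<phi>) * norm (X *v w)" using Ey[of w] by (simp add: algebra_simps)
    also have "\<dots> \<le> (1 + \<phi>) * (1.2273 * norm y)" using XR1[of w] w \<phi>0 by (intro mult_left_mono) auto
    finally show "norm (Q *v y) \<le> (1 + \<phi>) * 1.2273 * norm y" by (simp only: mult.assoc)
  qed
  moreover have "\<phi> \<le> 1.3153 * (1 / 383) * z"
    unfolding \<phi>_def using mu\<rho> z0 by (intro mult_right_mono mult_left_mono) auto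
  ultimately have z: "z \<le> 1.233" using z0 by simp
  then show "spectral_norm Q \<le> 1.25" by (simp add: z_def)
  have \<phi>1: "\<phi> \<le> 1.3153 * (?m * ?m * u * \<rho>) * 1.233"
    unfolding \<phi>_def using mu0 z by (intro mult_left_mono) auto
  then have \<phi>2: "\<phi> \<le> 0.005" using mu\<rho> by simp
  \<comment> \<open>Since \<rho> \<ge> 1, one factor \<rho> may be raised to its square, so that
    both relative errors become multiples of \<open>T\<close>.\<close>
  have "?m * ?m * u * \<rho> \<le> (t / 2) * \<rho>\<^sup>2"
    using mt \<rho> mm0 t by (intro mult_mono) (auto simp: power2_eq_square)
  then have \<phi>3: "\<phi> \<le> 0.811 * T" using \<phi>1 T by (simp add: T_def)
  have d2: "\<bar>(norm (Q *v (R *v y)))\<^sup>2 - (norm (X *v y))\<^sup>2\<bar> \<le> 2.005 * \<phi> * (norm (X *v y))\<^sup>2" for y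
  proof -
    define a b where "a = norm (Q *v (R *v y))" and "b = norm (X *v y)"
    have ab: "\<bar>a - b\<bar> \<le> \<phi> * b" "0 \<le> a" "0 \<le> b"
      using Ey[of y] norm_triangle_ineq3[of "Q *v (R *v y)" "X *v y"] QR[of y]
      by (auto simp: a_def b_def)
    have "\<bar>a\<^sup>2 - b\<^sup>2\<bar> = \<bar>a - b\<bar> * (a + b)"
      using ab by (simp add: power2_eq_square square_diff_square_factored abs_mult)
    also have "\<dots> \<le> (\<phi> * b) * (2.005 * b)"
    proof (intro mult_mono ab)
      have "\<phi> * b \<le> 0.005 * b" using \<phi>2 ab by (intro mult_right_mono) auto
      then show "a + b \<le> 2.005 * b" using ab by (simp add: abs_le_iff)
    qed (use ab \<phi>0 in auto)
    finally show ?thesis by (simp add: a_def b_def power2_eq_square mult_ac)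
  qed
  \<comment> \<open>The comparisons of Q x with X w and of X w with x = R w are added; 3.37 times
    1.506 is below 5.5.\<close>
  obtain w where w: "R *v w = x" using Rsurj by blast
  have "\<bar>(norm (Q *v x))\<^sup>2 - (norm x)\<^sup>2\<bar> \<le> (2.005 * \<phi> + 1.727 * T) * (norm (X *v w))\<^sup>2"
    using d1[of w] d2[of w] unfolding w distrib_right by linarith
  also have "\<dots> \<le> (3.37 * T) * (1.506 * (norm x)\<^sup>2)"
    using XR[of w] w T \<phi>3 \<phi>0 by (intro mult_mono) auto
  also have "\<dots> \<le> 5.5 * T * (norm x)\<^sup>2" using T by simp
  finally show "\<bar>(norm (Q *v x))\<^sup>2 - (norm x)\<^sup>2\<bar> \<le> 5.5 * t * \<rho>\<^sup>2 * (norm x)\<^sup>2"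
    by (simp add: T_def mult_ac)
qed

section \<open>From the embedding to the final bounds\<close>

lemma subspace_embedding_norm_bounds:
  fixes S :: "real ^ 'n ^ 'p"
  assumes "subspace_embedding \<epsilon> S W" "x \<in> W" "0 \<le> \<epsilon>" "\<epsilon> \<le> 1"
  shows "sqrt (1 - \<epsilon>) * norm x \<le> norm (S *v x)" and "norm (S *v x) \<le> sqrt (1 + \<epsilon>) * norm x"
proof -
  have "\<bar>(norm x)\<^sup>2 - (norm (S *v x))\<^sup>2\<bar> \<le> \<epsilon> * (norm x)\<^sup>2"
    using assms(1,2) unfolding subspace_embedding_def
    by (metis dot_square_norm mult.assoc power2_eq_square)
  then have "(1 - \<epsilon>) * (norm x)\<^sup>2 \<le> (norm (S *v x))\<^sup>2" "(norm (S *v x))\<^sup>2 \<le> (1 + \<epsilon>) * (norm x)\<^sup>2"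
    by (auto simp: abs_le_iff algebra_simps)
  then have "(sqrt (1 - \<epsilon>) * norm x)\<^sup>2 \<le> (norm (S *v x))\<^sup>2"
    "(norm (S *v x))\<^sup>2 \<le> (sqrt (1 + \<epsilon>) * norm x)\<^sup>2"
    using assms by (simp_all add: power_mult_distrib)
  then show "sqrt (1 - \<epsilon>) * norm x \<le> norm (S *v x)" "norm (S *v x) \<le> sqrt (1 + \<epsilon>) * norm x"
    using assms by (auto intro: power2_le_imp_le)
qed

lemma powr_three_halves: "0 \<le> x \<Longrightarrow> x powr (3 / 2) = x * sqrt x"
  using powr_add[of x 1 "1 / 2"] by (simp add: powr_half_sqrt)

text \<open>The deterministic core, for one drawn matrix that embeds the column space of
  \<open>V\<close>: the bounds for the sketched factor feed the Cholesky step, whose input then has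
  a condition bound depending only on \<epsilon>.\<close>

lemma fl_rand_cholQR_error:
  fixes S :: "real ^ 'n ^ 'p" and V Q :: "real ^ ('m :: {finite, linorder}) ^ 'n"
  assumes eps: "0 \<le> \<epsilon>" "\<epsilon> < 616 / 634"
    and emb: "subspace_embedding \<epsilon> S (range ((*v) V))"
    and rank: "rank V = CARD('m)"
    and m: "1 < CARD('m)" "CARD('m) \<le> CARD('p)" "CARD('m) \<le> CARD('n)" and u: "0 < u"
    and delta: "sketch_delta \<epsilon> u S V \<le> 1"
    and fl: "fl_rand_cholQR u S V Q R"
  shows "spectral_norm (transpose Q ** Q - mat 1)
        \<le> 5445 / (25 * sqrt ((1 - \<epsilon>) / (1 + \<epsilon>)) - 3)\<^sup>2
          * (real CARD('n) * real CARD('m) + real CARD('m) * (real CARD('m) + 1)) * u"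
    and "spectral_norm (V - Q ** R)
        \<le> (56 / (25 * ((1 - \<epsilon>) / sqrt (1 + \<epsilon>)) - 3 * sqrt (1 - \<epsilon>))
            + 1.5 / sqrt (1 - \<epsilon>)
              * sqrt (1 + 5445 * (real CARD('n) * real CARD('m)
                                   + real CARD('m) * (real CARD('m) + 1)) * u
                          / (25 * sqrt ((1 - \<epsilon>) / (1 + \<epsilon>)) - 3)\<^sup>2))
          * (sqrt (1 + \<epsilon>) * spectral_norm V
              + sqrt (1 - \<epsilon>) / 12 * sigma_min V * sketch_delta \<epsilon> u S V)
          * (real CARD('m))\<^sup>2 * u
          + sketch_delta \<epsilon> u S V / 10 * sigma_min V"
proof -
  let ?m = "real CARD('m)" and ?n = "real CARD('n)" and ?p = "real CARD('p)"
  define A B D v w where "A = sqrt (1 - \<epsilon>)" and "B = sqrt (1 + \<epsilon>)" and "D = sketch_delta \<epsilon> u S V"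
    and "v = spectral_norm V" and "w = sigma_min V"
  define t where "t = (?n * ?m + ?m * (?m + 1)) * u"
  have A: "0 < A" "A \<le> 1" using eps by (auto simp: A_def)
  have A2: "A\<^sup>2 = 1 - \<epsilon>" and B2: "B\<^sup>2 = 1 + \<epsilon>" using eps by (auto simp: A_def B_def)
  have B: "1 \<le> B" using eps by (simp add: B_def)
  \<comment> \<open>Squared, this is exactly \<epsilon> < 616 / 634; it also makes the denominators
    of the claim positive.\<close>
  have BA: "B < 25 / 3 * A"
  proof (rule power2_less_imp_less)
    show "B\<^sup>2 < (25 / 3 * A)\<^sup>2" using eps by (simp add: power_mult_distrib A2 B2 power_divide)
  qed (use A in simp)
  have B': "B \<le> 1.4143"
  proof (rule power2_le_imp_le)
    show "B\<^sup>2 \<le> (1.4143)\<^sup>2" using eps by (simp add: B2 power_divide)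
  qed simp
  have w: "0 < w" "w \<le> v"
    using sigma_min_pos[OF rank] sigma_min_le_spectral_norm[of V] by (auto simp: w_def v_def)
  have Vw: "w * norm x \<le> norm (V *v x)" and Vv: "norm (V *v x) \<le> v * norm x" for x
    unfolding w_def v_def by (rule sigma_min_le, rule norm_mult_vec_le_onorm)
  have S: "A * norm y \<le> norm (S *v y)" "norm (S *v y) \<le> B * norm y" if "y \<in> range ((*v) V)" for y
    using subspace_embedding_norm_bounds[OF emb that] eps by (auto simp: A_def B_def)
  have sub: "subspace (range ((*v) V))"
    by (intro linear_subspace_image matrix_vector_mul_linear subspace_UNIV)
  have nS: "sqrt ?m * A \<le> norm S"
    using frobenius_ge_on_subspace[OF sub _ S(1)] A rank by (simp add: rank_dim_range)
  \<comment> \<open>\<delta> contains \<open>sigma_max V\<close>, while the analysis uses the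
    spectral norm \<open>v\<close>, which is at most that.\<close>
  define K where "K = 383 * (?p * (?m * sqrt ?m) + sqrt ?m * (?p * sqrt ?p * B + ?n * norm S)) * u"
  have "K * v \<le> K * sigma_max V"
    using spectral_norm_le_sigma_max[of V] u B unfolding v_def K_def
    by (intro mult_left_mono mult_nonneg_nonneg add_nonneg_nonneg) auto
  also have "\<dots> = A * D * w"
    using A w by (simp add: D_def K_def sketch_delta_def condition_number_def powr_three_halves
        A_def[symmetric] B_def[symmetric] w_def[symmetric])
  finally have key: "K * v \<le> A * D * w" .
  have D: "D \<le> 1" using delta by (simp add: D_def)
  have m2: "2 \<le> CARD('m)" using m by simp
  have mr: "2 \<le> ?m" "?m \<le> ?p" using m by auto
  note rb = roundoff_bounds[OF mr of_nat_0_le_iff u A B w D nS key[unfolded K_def]]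
  obtain Q0 R0 R1 where Q0: "fl_randQR u S V Q0 R0" and Q1: "fl_cholQR u Q0 Q R1"
    and R: "fl_matmul u R1 R0 R"
    using fl unfolding fl_rand_cholQR_def by blast
  note qr = fl_randQR_bounds[OF Vw Vv S A B B' less_imp_le[OF BA] w m2 m(2) u D nS
      key[unfolded K_def] Q0, simplified]
  define \<rho> where "\<rho> = B / A"
  have \<rho>: "1 \<le> \<rho>" "\<rho> < 25 / 3" using A B BA by (auto simp: \<rho>_def field_simps)
  define q where "q = 1.132 / A"
  \<comment> \<open>1.132 / 0.866 is below 1.31.\<close>
  have q: "0 \<le> q" "q \<le> 1.31 * \<rho> * (0.866 / B)" using A B by (auto simp: q_def \<rho>_def field_simps)
  have l: "0 < 0.866 / B" using B by simp
  have mu\<rho>: "?m * ?m * u * \<rho> \<le> 1 / 383" using rb(4) A by (simp add: \<rho>_def field_simps)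
  have qX: "norm (Q0 *v x) \<le> q * norm x" for x using qr(2)[of x] by (simp add: q_def)
  have lX: "0.866 / B * norm x \<le> norm (Q0 *v x)" for x using qr(3)[of x] by simp
  have nmu: "?n * ?m * u + 1.5 * (?m * ?m * u) \<le> 1.07 / 383" using rb(1) by simp
  note ch = fl_cholQR_bounds[OF lX qX l q \<rho>(1) less_imp_le[OF \<rho>(2)] m2 m(3) u nmu mu\<rho> Q1, folded t_def]
  define z where "z = spectral_norm Q"
  have z: "0 \<le> z" "z \<le> 1.25" using ch(2) by (auto simp: z_def onorm_pos_le)
  \<comment> \<open>The bracket in the claimed bounds. It equals 25 / \<rho> - 3, is positive
    because \<rho> < 25 / 3, and is at most 22 because \<rho> \<ge> 1.\<close>
  define Y where "Y = 25 * sqrt ((1 - \<epsilon>) / (1 + \<epsilon>)) - 3"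
  have Y_eq: "Y = 25 / \<rho> - 3"
    by (simp add: Y_def \<rho>_def A_def B_def real_sqrt_divide)
  have Y: "0 < Y" "Y \<le> 22" "Y \<le> 25 / \<rho>" using \<rho> by (auto simp: Y_eq field_simps)
  define T where "T = 5445 / Y\<^sup>2 * t"
  have t0: "0 \<le> t" using u by (simp add: t_def)
  \<comment> \<open>\<open>\<rho> * Y\<close> is at most 25, and 5.5 times 625 is below
    5445.\<close>
  have "5.5 * \<rho>\<^sup>2 \<le> 5445 / Y\<^sup>2"
  proof -
    have "(\<rho> * Y)\<^sup>2 \<le> 25\<^sup>2" using Y \<rho> by (intro power_mono) (auto simp: field_simps)
    then show ?thesis using Y by (simp add: field_simps power_mult_distrib)
  qed
  then have T: "5.5 * t * \<rho>\<^sup>2 \<le> T" using t0 mult_right_mono[of "5.5 * \<rho>\<^sup>2" "5445 / Y\<^sup>2" t]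
    by (simp add: T_def mult_ac)
  have QT: "\<bar>(norm (Q *v x))\<^sup>2 - (norm x)\<^sup>2\<bar> \<le> T * (norm x)\<^sup>2" for x
    using ch(1)[of x] mult_right_mono[OF T, of "(norm x)\<^sup>2"] by simp
  have "spectral_norm (transpose Q ** Q - mat 1) \<le> T"
  proof (rule onorm_symmetric_le)
    show "transpose (transpose Q ** Q - mat 1) = transpose Q ** Q - mat 1"
      by (simp add: transpose_diff matrix_transpose_mul transpose_mat)
    show "\<bar>x \<bullet> ((transpose Q ** Q - mat 1) *v x)\<bar> \<le> T * (norm x)\<^sup>2" for x
      using QT[of x] unfolding matrix_vector_mult_diff_rdistrib inner_diff_right quadratic_form_gram
      by (simp add: dot_square_norm)
  qed
  then show "spectral_norm (transpose Q ** Q - mat 1)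
        \<le> 5445 / (25 * sqrt ((1 - \<epsilon>) / (1 + \<epsilon>)) - 3)\<^sup>2
          * (real CARD('n) * real CARD('m) + real CARD('m) * (real CARD('m) + 1)) * u"
    by (simp only: T_def Y_def t_def mult.assoc)
  have T0: "0 \<le> T" using t0 by (simp add: T_def)
  have zT: "z \<le> sqrt (1 + T)"
    unfolding z_def
  proof (rule onorm_le)
    fix x
    have "(norm (Q *v x))\<^sup>2 \<le> (1 + T) * (norm x)\<^sup>2" using QT[of x] by (simp add: abs_le_iff algebra_simps)
    also have "\<dots> = (sqrt (1 + T) * norm x)\<^sup>2" using T0 by (simp add: power_mult_distrib)
    finally show "norm (Q *v x) \<le> sqrt (1 + T) * norm x" by (rule power2_le_imp_le) (use T0 in simp)
  qed
  define r where "r = 1.114 * B * v"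
  have r0: "0 \<le> r" using B w by (simp add: r_def)
  have R0r: "norm (R0 *v x) \<le> r * norm x" for x using qr(1)[of x] by (simp add: r_def)
  have nR0: "norm R0 \<le> sqrt ?m * r" by (rule frobenius_le_op[OF R0r r0])
  define E1 E2 E3 where "E1 = V - Q0 ** R0" and "E2 = Q0 - Q ** R1" and "E3 = R - R1 ** R0"
  have mu: "?m * u \<le> 0.0014"
  proof -
    have "2 * (?m * u) \<le> ?m * (?m * u)" using mr u by (intro mult_right_mono) auto
    moreover have "0 \<le> ?n * ?m * u" using u by simp
    ultimately show ?thesis using nmu by (simp add: mult_ac)
  qed
  have gm: "0 \<le> gam u CARD('m)" "gam u CARD('m) \<le> 1.002 * (?m * u)"
    using gam_nonneg[OF _ mu] gam_le[OF _ mu] u by auto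
  have nE3: "norm E3 \<le> 1.004 * (?m\<^sup>2 * u * q * r)"
  proof -
    have "norm E3 \<le> gam u CARD('m) * norm R1 * norm R0"
      using fl_matmul_error[OF R gm(1)] by (simp add: E3_def)
    also have "\<dots> \<le> 1.002 * (?m * u) * (sqrt ?m * (1.0015 * q)) * (sqrt ?m * r)"
      using gm ch(3) nR0 q r0 u by (intro mult_mono) auto
    also have "\<dots> = 1.002 * 1.0015 * (?m * u) * (sqrt ?m * sqrt ?m) * (q * r)" by simp
    also have "\<dots> = 1.002 * 1.0015 * (?m\<^sup>2 * u * q * r)" by (simp add: power2_eq_square)
    also have "\<dots> \<le> 1.004 * (?m\<^sup>2 * u * q * r)"
      using q r0 u by (intro mult_right_mono mult_nonneg_nonneg) auto
    finally show ?thesis .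
  qed
  \<comment> \<open>The residual splits into that of the sketched step, that of the Cholesky step
    carried by \<open>R0\<close>, and the error of forming R1 R0 carried by
    \<open>Q\<close>.\<close>
  have VQR: "(V - Q ** R) *v x = E1 *v x + E2 *v (R0 *v x) - Q *v (E3 *v x)" for x
    by (simp add: E1_def E2_def E3_def matrix_vector_mult_diff_rdistrib
        matrix_vector_mult_diff_distrib mult_vec_split)
  define F where "F = ?m\<^sup>2 * u * z * q * r"
  have "spectral_norm (V - Q ** R) \<le> 2.014 * F + D * w / 10"
  proof (rule onorm_le)
    fix x
    have 1: "norm (E1 *v x) \<le> D * w / 10 * norm x"
      using norm_mult_vec_le[of E1 x] mult_right_mono[OF qr(4) norm_ge_zero[of x]]
      by (simp add: E1_def)
    have "norm (E2 *v (R0 *v x)) \<le> norm E2 * norm (R0 *v x)" by (rule norm_mult_vec_le)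
    also have "\<dots> \<le> (1.01 * ?m\<^sup>2 * u * z * q) * (r * norm x)"
      using ch(4) R0r u z q by (intro mult_mono) (auto simp: E2_def z_def)
    finally have 2: "norm (E2 *v (R0 *v x)) \<le> 1.01 * F * norm x" by (simp add: F_def mult_ac)
    have "norm (Q *v (E3 *v x)) \<le> z * norm (E3 *v x)" unfolding z_def by (rule norm_mult_vec_le_onorm)
    also have "\<dots> \<le> z * (norm E3 * norm x)" using z by (intro mult_left_mono norm_mult_vec_le) auto
    also have "\<dots> \<le> z * (1.004 * (?m\<^sup>2 * u * q * r) * norm x)"
      using z by (intro mult_left_mono mult_right_mono nE3) auto
    finally have 3: "norm (Q *v (E3 *v x)) \<le> 1.004 * F * norm x" by (simp add: F_def mult_ac)
    have "norm ((V - Q ** R) *v x) \<le> norm (E1 *v x) + norm (E2 *v (R0 *v x)) + norm (Q *v (E3 *v x))"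
      unfolding VQR by (meson add_right_mono norm_triangle_ineq norm_triangle_ineq4 order_trans)
    also have "\<dots> \<le> D * w / 10 * norm x + 1.01 * F * norm x + 1.004 * F * norm x"
      by (intro add_mono 1 2 3)
    also have "\<dots> = (2.014 * F + D * w / 10) * norm x" by (simp add: algebra_simps)
    finally show "norm ((V - Q ** R) *v x) \<le> (2.014 * F + D * w / 10) * norm x" .
  qed
  moreover have "2.014 * F \<le> (56 / (A * Y) + 1.5 / A * sqrt (1 + T)) * (B * v + A / 12 * w * D) * ?m\<^sup>2 * u"
  proof -
    define P where "P = B * v * ?m\<^sup>2 * u / A"
    have P: "0 \<le> P" using B w u A by (simp add: P_def)
    have D0: "0 \<le> D" using rb(6) .
    have "2.014 * F = 2.014 * 1.132 * 1.114 * z * P" by (simp add: F_def q_def r_def P_def)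
    also have "\<dots> \<le> 2.54 * z * P" using z P by (intro mult_right_mono) auto
    also have "\<dots> \<le> (56 / Y + 1.5 * sqrt (1 + T)) * P"
    proof (rule mult_right_mono[OF _ P])
      \<comment> \<open>Of the coefficient 2.54, the part 1.5 is covered by \<open>zT\<close> and
        the remaining 1.04 by 56 / 22, since \<open>z \<le> 1.25\<close>.\<close>
      have "56 / 22 \<le> 56 / Y" using Y by (intro divide_left_mono) auto
      then show "2.54 * z \<le> 56 / Y + 1.5 * sqrt (1 + T)" using z zT by simp
    qed
    also have "\<dots> = (56 / (A * Y) + 1.5 / A * sqrt (1 + T)) * (B * v) * ?m\<^sup>2 * u"
      using A Y by (simp add: P_def field_simps)
    also have "\<dots> \<le> (56 / (A * Y) + 1.5 / A * sqrt (1 + T)) * (B * v + A / 12 * w * D) * ?m\<^sup>2 * u"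
      using A Y T0 D0 w u by (intro mult_right_mono mult_left_mono) auto
    finally show ?thesis .
  qed
  ultimately have "spectral_norm (V - Q ** R)
      \<le> (56 / (A * Y) + 1.5 / A * sqrt (1 + T)) * (B * v + A / 12 * w * D) * ?m\<^sup>2 * u + D / 10 * w"
    by simp
  moreover have "A * Y = 25 * ((1 - \<epsilon>) / sqrt (1 + \<epsilon>)) - 3 * sqrt (1 - \<epsilon>)"
    using A by (simp add: Y_eq \<rho>_def A2[symmetric] B_def[symmetric] A_def[symmetric]
        power2_eq_square right_diff_distrib)
  moreover have "T = 5445 * (?n * ?m + ?m * (?m + 1)) * u / (25 * sqrt ((1 - \<epsilon>) / (1 + \<epsilon>)) - 3)\<^sup>2"
    by (simp add: T_def t_def Y_def)
  ultimately show "spectral_norm (V - Q ** R)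
        \<le> (56 / (25 * ((1 - \<epsilon>) / sqrt (1 + \<epsilon>)) - 3 * sqrt (1 - \<epsilon>))
            + 1.5 / sqrt (1 - \<epsilon>)
              * sqrt (1 + 5445 * (real CARD('n) * real CARD('m)
                                   + real CARD('m) * (real CARD('m) + 1)) * u
                          / (25 * sqrt ((1 - \<epsilon>) / (1 + \<epsilon>)) - 3)\<^sup>2))
          * (sqrt (1 + \<epsilon>) * spectral_norm V
              + sqrt (1 - \<epsilon>) / 12 * sigma_min V * sketch_delta \<epsilon> u S V)
          * (real CARD('m))\<^sup>2 * u
          + sketch_delta \<epsilon> u S V / 10 * sigma_min V"
    by (simp only: A_def B_def D_def v_def w_def)
qed

text \<open>Randomness enters only through the event that the column space of \<open>V\<close> is
  embedded; on it the deterministic estimate covers every admissible output. The condition on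
  \<open>sketch_delta\<close> stands inside the event because it depends on the drawn
  matrix.\<close>

theorem corollary5p3:
  fixes M :: "'w measure"
    and S :: "'w \<Rightarrow> real ^ 'n ^ 'p"
    and V :: "real ^ ('m :: {finite, linorder}) ^ 'n"
    and \<epsilon> d u :: real
  assumes "prob_space M"
    and "0 \<le> \<epsilon>" and "\<epsilon> < 616 / 634"
    and "oblivious_subspace_embedding M S \<epsilon> d CARD('m)"
    and "rank V = CARD('m)"
    and "1 < CARD('m)" and "CARD('m) \<le> CARD('p)" and "CARD('p) \<le> CARD('n)"
    and "0 < u"
    and "real CARD('n) * real CARD('m) * u \<le> 1 / 12"
    and "real CARD('p) powr (3/2) * u \<le> 1 / 12"
  shows "holds_with_prob_ge M (1 - d) (\<lambda>\<omega>. sketch_delta \<epsilon> u (S \<omega>) V \<le> 1 \<longrightarrow>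
    (\<forall>Q R. fl_rand_cholQR u (S \<omega>) V Q R \<longrightarrow>
      spectral_norm (transpose Q ** Q - mat 1)
        \<le> 5445 / (25 * sqrt ((1 - \<epsilon>) / (1 + \<epsilon>)) - 3)\<^sup>2
          * (real CARD('n) * real CARD('m) + real CARD('m) * (real CARD('m) + 1)) * u
      \<and>
      spectral_norm (V - Q ** R)
        \<le> (56 / (25 * ((1 - \<epsilon>) / sqrt (1 + \<epsilon>)) - 3 * sqrt (1 - \<epsilon>))
            + 1.5 / sqrt (1 - \<epsilon>)
              * sqrt (1 + 5445 * (real CARD('n) * real CARD('m)
                                   + real CARD('m) * (real CARD('m) + 1)) * u
                          / (25 * sqrt ((1 - \<epsilon>) / (1 + \<epsilon>)) - 3)\<^sup>2))
          * (sqrt (1 + \<epsilon>) * spectral_norm V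
              + sqrt (1 - \<epsilon>) / 12 * sigma_min V * sketch_delta \<epsilon> u (S \<omega>) V)
          * (real CARD('m))\<^sup>2 * u
          + sketch_delta \<epsilon> u (S \<omega>) V / 10 * sigma_min V))"
proof -
  let ?W = "range ((*v) V)" and ?q = "1 - d"
  define E where "E = {\<omega> \<in> space M. subspace_embedding \<epsilon> (S \<omega>) ?W}"
  have "subspace ?W" by (intro linear_subspace_image matrix_vector_mul_linear subspace_UNIV)
  moreover have "dim ?W = CARD('m)" using assms(5) by (simp add: rank_dim_range)
  ultimately have E: "measure M E \<ge> ?q"
    using assms(4) unfolding oblivious_subspace_embedding_def E_def by blast
  \<comment> \<open>A non-measurable set has measure \<open>0\<close>, so measurability of the embedding event is not an issue.\<close>
  define F where "F = (if E \<in> sets M then E else {})"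
  have "F \<in> sets M" "measure M F \<ge> ?q" "F \<subseteq> E"
    using E measure_notin_sets[of E M] by (auto simp: F_def)
  moreover have mn: "CARD('m) \<le> CARD('n)" using assms(7,8) by simp
  note error = fl_rand_cholQR_error[OF assms(2,3) _ assms(5,6,7) mn assms(9)]
  ultimately show ?thesis
    unfolding holds_with_prob_ge_def
    by (intro bexI[of _ F] conjI ballI impI allI) (auto simp only: E_def intro: error)
qed

end
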